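(* Let $k\in\{1,2,3\}$, and let $\alpha,\sigma,\lambda,f,g^2,t_\lambda,\epsilon_\theta$ and the algorithm DPM-Solver-$k$ be as in the context. Let $x_T\in\mathbb{R}^D$ and let $(x_t)_{t\in[0,T]}$ be the solution of the diffusion ODE $$\frac{\mathrm{d}x_t}{\mathrm{d}t}=f(t)\,x_t+\frac{g^2(t)}{2\sigma_t}\,\epsilon_\theta(x_t,t)$$ on $[0,T]$ with value $x_T$ at time $T$. Put $\hat x_\lambda:=x_{t_\lambda(\lambda)}$ and $\hat\epsilon_\theta(\hat x_\lambda,\lambda):=\epsilon_\theta(x_{t_\lambda(\lambda)},t_\lambda(\lambda))$ for $\lambda\in[\lambda_T,\lambda_0]$. Assume: (1) the total derivatives $\frac{\mathrm{d}^j}{\mathrm{d}\lambda^j}\hat\epsilon_\theta(\hat x_\lambda,\lambda)$, as functions of $\lambda\in[\lambda_T,\lambda_0]$, exist and are continuous for $0\le j\le k+1$; (2) $\epsilon_\theta(x,s)$ is Lipschitz with respect to its first argument $x$: there is $L\ge 0$ with $\|\epsilon_\theta(x,s)-\epsilon_\theta(y,s)\|\le L\|x-y\|$ for all $x,y\in\mathbb{R}^D$ and $s\in[0,T]$. Then DPM-Solver-$k$ is a $k$-th order solver for the diffusion ODE, in the following sense. For every constant $c>0$ there is a constant $C>0$, independent of $M$ and of the choice of time steps, such that for every $M\ge 1$ and all time steps $T=t_0>t_1>\dots>t_M=0$ with $$h_{\max}:=\max_{1\le i\le M}(\lambda_{t_i}-\lambda_{t_{i-1}})\le \frac{c}{M},$$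 the sequence $\{\tilde x_{t_i}\}_{i=0}^M$ computed by DPM-Solver-$k$ from the initial value $x_T$ satisfies $$\|\tilde x_{t_M}-x_0\|\le C\,h_{\max}^{k}.$$ That is, $\tilde x_{t_M}-x_0=O(h_{\max}^k)$ under the assumption $h_{\max}=O(1/M)$.
   Context: Fix $T>0$ and $D\ge 1$; $\|\cdot\|$ is the Euclidean norm on $\mathbb{R}^D$. The noise schedule consists of differentiable functions $\alpha,\sigma:[0,T]\to(0,\infty)$ with bounded derivatives, written $\alpha_t=\alpha(t)$, $\sigma_t=\sigma(t)$, such that $\alpha_t^2/\sigma_t^2$ is strictly decreasing in $t$. Define $$f(t)=\frac{\mathrm{d}\log\alpha_t}{\mathrm{d}t},\qquad g^2(t)=\frac{\mathrm{d}\sigma_t^2}{\mathrm{d}t}-2\,\frac{\mathrm{d}\log\alpha_t}{\mathrm{d}t}\,\sigma_t^2 .$$ Let $\lambda_t=\lambda(t):=\log(\alpha_t/\sigma_t)$, a strictly decreasing function of $t$, with inverse function $t_\lambda(\cdot):[\lambda_T,\lambda_0]\to[0,T]$, so $t=t_\lambda(\lambda(t))$. The noise prediction model is a function $\epsilon_\theta:\mathbb{R}^D\times[0,T]\to\mathbb{R}^D$ with fixed parameters $\theta$. The solvers. Given an initial value $x_T$ and time steps $T=t_0>t_1>\dots>t_M=0$, put $h_i:=\lambda_{t_i}-\lambda_{t_{i-1}}>0$ and $\tilde x_{t_0}:=x_T$. For $i=1,\dots,M$, compute $\tilde x_{t_i}$ from $\tilde x_{t_{i-1}}$ as follows. DPM-Solver-1: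 $$\tilde x_{t_i}=\frac{\alpha_{t_i}}{\alpha_{t_{i-1}}}\tilde x_{t_{i-1}}-\sigma_{t_i}(e^{h_i}-1)\,\epsilon_\theta(\tilde x_{t_{i-1}},t_{i-1}).$$ DPM-Solver-2: with $s_i=t_\lambda\!\left(\frac{\lambda_{t_{i-1}}+\lambda_{t_i}}{2}\right)$, $$u_i=\frac{\alpha_{s_i}}{\alpha_{t_{i-1}}}\tilde x_{t_{i-1}}-\sigma_{s_i}\left(e^{h_i/2}-1\right)\epsilon_\theta(\tilde x_{t_{i-1}},t_{i-1}),$$ $$\tilde x_{t_i}=\frac{\alpha_{t_i}}{\alpha_{t_{i-1}}}\tilde x_{t_{i-1}}-\sigma_{t_i}\left(e^{h_i}-1\right)\epsilon_\theta(u_i,s_i).$$ DPM-Solver-3: with $r_1=\frac13$, $r_2=\frac23$, $s_{2i-1}=t_\lambda(\lambda_{t_{i-1}}+r_1h_i)$, $s_{2i}=t_\lambda(\lambda_{t_{i-1}}+r_2h_i)$, $$u_{2i-1}=\frac{\alpha_{s_{2i-1}}}{\alpha_{t_{i-1}}}\tilde x_{t_{i-1}}-\sigma_{s_{2i-1}}\left(e^{r_1h_i}-1\right)\epsilon_\theta(\tilde x_{t_{i-1}},t_{i-1}),$$ $$D_{2i-1}=\epsilon_\theta(u_{2i-1},s_{2i-1})-\epsilon_\theta(\tilde x_{t_{i-1}},t_{i-1}),$$ $$u_{2i}=\frac{\alpha_{s_{2i}}}{\alpha_{t_{i-1}}}\tilde x_{t_{i-1}}-\sigma_{s_{2i}}\left(e^{r_2h_i}-1\right)\epsilon_\theta(\tilde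 x_{t_{i-1}},t_{i-1})-\frac{\sigma_{s_{2i}}r_2}{r_1}\left(\frac{e^{r_2h_i}-1}{r_2h_i}-1\right)D_{2i-1},$$ $$D_{2i}=\epsilon_\theta(u_{2i},s_{2i})-\epsilon_\theta(\tilde x_{t_{i-1}},t_{i-1}),$$ $$\tilde x_{t_i}=\frac{\alpha_{t_i}}{\alpha_{t_{i-1}}}\tilde x_{t_{i-1}}-\sigma_{t_i}\left(e^{h_i}-1\right)\epsilon_\theta(\tilde x_{t_{i-1}},t_{i-1})-\frac{\sigma_{t_i}}{r_2}\left(\frac{e^{h_i}-1}{h_i}-1\right)D_{2i}.$$ *)

theory Defs
  imports "HOL-Analysis.Analysis"
begin

text \<open>
  Functions on \<open>[0,T]\<close> are total functions on the reals of which only the values on \<open>{0..T}\<close> are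
  used; derivatives are taken within the interval, hence one-sided at the end points.
\<close>

definition noise_schedule :: "real \<Rightarrow> (real \<Rightarrow> real) \<Rightarrow> (real \<Rightarrow> real) \<Rightarrow> bool" where
  "noise_schedule T \<alpha> \<sigma> \<longleftrightarrow>
     (\<forall>t\<in>{0..T}. 0 < \<alpha> t \<and> 0 < \<sigma> t) \<and>
     \<alpha> differentiable_on {0..T} \<and> \<sigma> differentiable_on {0..T} \<and>
     bounded ((\<lambda>t. vector_derivative \<alpha> (at t within {0..T})) ` {0..T}) \<and>
     bounded ((\<lambda>t. vector_derivative \<sigma> (at t within {0..T})) ` {0..T}) \<and>
     monotone_on {0..T} (<) (>) (\<lambda>t. (\<alpha> t)\<^sup>2 / (\<sigma> t)\<^sup>2)"

definition drift :: "real \<Rightarrow> (real \<Rightarrow> real) \<Rightarrow> real \<Rightarrow> real" where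
  "drift T \<alpha> t = vector_derivative (\<lambda>s. ln (\<alpha> s)) (at t within {0..T})"

definition diffusion_sq :: "real \<Rightarrow> (real \<Rightarrow> real) \<Rightarrow> (real \<Rightarrow> real) \<Rightarrow> real \<Rightarrow> real" where
  "diffusion_sq T \<alpha> \<sigma> t =
     vector_derivative (\<lambda>s. (\<sigma> s)\<^sup>2) (at t within {0..T}) - 2 * drift T \<alpha> t * (\<sigma> t)\<^sup>2"

definition lam :: "(real \<Rightarrow> real) \<Rightarrow> (real \<Rightarrow> real) \<Rightarrow> real \<Rightarrow> real" where
  "lam \<alpha> \<sigma> t = ln (\<alpha> t / \<sigma> t)"

definition t_lam :: "real \<Rightarrow> (real \<Rightarrow> real) \<Rightarrow> (real \<Rightarrow> real) \<Rightarrow> real \<Rightarrow> real" where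
  "t_lam T \<alpha> \<sigma> = the_inv_into {0..T} (lam \<alpha> \<sigma>)"

definition diffusion_ode_solution ::
  "real \<Rightarrow> (real \<Rightarrow> real) \<Rightarrow> (real \<Rightarrow> real) \<Rightarrow> (real ^ 'n \<Rightarrow> real \<Rightarrow> real ^ 'n) \<Rightarrow>
   real ^ 'n \<Rightarrow> (real \<Rightarrow> real ^ 'n) \<Rightarrow> bool" where
  "diffusion_ode_solution T \<alpha> \<sigma> \<epsilon> xT x \<longleftrightarrow>
     (\<forall>t\<in>{0..T}. (x has_vector_derivative
        (drift T \<alpha> t *\<^sub>R x t + (diffusion_sq T \<alpha> \<sigma> t / (2 * \<sigma> t)) *\<^sub>R \<epsilon> (x t) t))
        (at t within {0..T})) \<and>
     x T = xT"

text \<open>\<open>d j\<close> is the \<open>j\<close>-th derivative of \<open>g\<close> on \<open>S\<close>.\<close>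

definition has_continuous_derivatives_upto ::
  "nat \<Rightarrow> (real \<Rightarrow> 'a::real_normed_vector) \<Rightarrow> real set \<Rightarrow> bool" where
  "has_continuous_derivatives_upto n g S \<longleftrightarrow>
     (\<exists>d. (\<forall>u\<in>S. d 0 u = g u) \<and>
          (\<forall>j<n. \<forall>u\<in>S. (d j has_vector_derivative d (Suc j) u) (at u within S)) \<and>
          (\<forall>j\<le>n. continuous_on S (d j)))"

text \<open>One step of each solver, from time \<open>s\<close> with value \<open>x\<close> to time \<open>t < s\<close>.\<close>

definition dpm_step1 ::
  "(real \<Rightarrow> real) \<Rightarrow> (real \<Rightarrow> real) \<Rightarrow> (real ^ 'n \<Rightarrow> real \<Rightarrow> real ^ 'n) \<Rightarrow>
   real \<Rightarrow> real \<Rightarrow> real ^ 'n \<Rightarrow> real ^ 'n" where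
  "dpm_step1 \<alpha> \<sigma> \<epsilon> s t x =
     (let h = lam \<alpha> \<sigma> t - lam \<alpha> \<sigma> s
      in (\<alpha> t / \<alpha> s) *\<^sub>R x - (\<sigma> t * (exp h - 1)) *\<^sub>R \<epsilon> x s)"

definition dpm_step2 ::
  "real \<Rightarrow> (real \<Rightarrow> real) \<Rightarrow> (real \<Rightarrow> real) \<Rightarrow> (real ^ 'n \<Rightarrow> real \<Rightarrow> real ^ 'n) \<Rightarrow>
   real \<Rightarrow> real \<Rightarrow> real ^ 'n \<Rightarrow> real ^ 'n" where
  "dpm_step2 T \<alpha> \<sigma> \<epsilon> s t x =
     (let h = lam \<alpha> \<sigma> t - lam \<alpha> \<sigma> s;
          s' = t_lam T \<alpha> \<sigma> ((lam \<alpha> \<sigma> s + lam \<alpha> \<sigma> t) / 2);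
          u = (\<alpha> s' / \<alpha> s) *\<^sub>R x - (\<sigma> s' * (exp (h / 2) - 1)) *\<^sub>R \<epsilon> x s
      in (\<alpha> t / \<alpha> s) *\<^sub>R x - (\<sigma> t * (exp h - 1)) *\<^sub>R \<epsilon> u s')"

definition dpm_step3 ::
  "real \<Rightarrow> (real \<Rightarrow> real) \<Rightarrow> (real \<Rightarrow> real) \<Rightarrow> (real ^ 'n \<Rightarrow> real \<Rightarrow> real ^ 'n) \<Rightarrow>
   real \<Rightarrow> real \<Rightarrow> real ^ 'n \<Rightarrow> real ^ 'n" where
  "dpm_step3 T \<alpha> \<sigma> \<epsilon> s t x =
     (let r1 = 1 / 3; r2 = 2 / 3;
          h = lam \<alpha> \<sigma> t - lam \<alpha> \<sigma> s;
          s1 = t_lam T \<alpha> \<sigma> (lam \<alpha> \<sigma> s + r1 * h);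
          s2 = t_lam T \<alpha> \<sigma> (lam \<alpha> \<sigma> s + r2 * h);
          u1 = (\<alpha> s1 / \<alpha> s) *\<^sub>R x - (\<sigma> s1 * (exp (r1 * h) - 1)) *\<^sub>R \<epsilon> x s;
          D1 = \<epsilon> u1 s1 - \<epsilon> x s;
          u2 = (\<alpha> s2 / \<alpha> s) *\<^sub>R x - (\<sigma> s2 * (exp (r2 * h) - 1)) *\<^sub>R \<epsilon> x s
               - (\<sigma> s2 * r2 / r1 * ((exp (r2 * h) - 1) / (r2 * h) - 1)) *\<^sub>R D1;
          D2 = \<epsilon> u2 s2 - \<epsilon> x s
      in (\<alpha> t / \<alpha> s) *\<^sub>R x - (\<sigma> t * (exp h - 1)) *\<^sub>R \<epsilon> x s
           - (\<sigma> t / r2 * ((exp h - 1) / h - 1)) *\<^sub>R D2)"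

text \<open>Only the orders \<open>k = 1, 2, 3\<close> are meaningful.\<close>

definition dpm_step ::
  "nat \<Rightarrow> real \<Rightarrow> (real \<Rightarrow> real) \<Rightarrow> (real \<Rightarrow> real) \<Rightarrow> (real ^ 'n \<Rightarrow> real \<Rightarrow> real ^ 'n) \<Rightarrow>
   real \<Rightarrow> real \<Rightarrow> real ^ 'n \<Rightarrow> real ^ 'n" where
  "dpm_step k T \<alpha> \<sigma> \<epsilon> =
     (if k = 1 then dpm_step1 \<alpha> \<sigma> \<epsilon>
      else if k = 2 then dpm_step2 T \<alpha> \<sigma> \<epsilon>
      else dpm_step3 T \<alpha> \<sigma> \<epsilon>)"

primrec dpm_solver ::
  "nat \<Rightarrow> real \<Rightarrow> (real \<Rightarrow> real) \<Rightarrow> (real \<Rightarrow> real) \<Rightarrow> (real ^ 'n \<Rightarrow> real \<Rightarrow> real ^ 'n) \<Rightarrow>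
   real ^ 'n \<Rightarrow> (nat \<Rightarrow> real) \<Rightarrow> nat \<Rightarrow> real ^ 'n" where
  "dpm_solver k T \<alpha> \<sigma> \<epsilon> xT ts 0 = xT"
| "dpm_solver k T \<alpha> \<sigma> \<epsilon> xT ts (Suc i) =
     dpm_step k T \<alpha> \<sigma> \<epsilon> (ts i) (ts (Suc i)) (dpm_solver k T \<alpha> \<sigma> \<epsilon> xT ts i)"

definition time_steps :: "real \<Rightarrow> nat \<Rightarrow> (nat \<Rightarrow> real) \<Rightarrow> bool" where
  "time_steps T M ts \<longleftrightarrow> ts 0 = T \<and> ts M = 0 \<and> (\<forall>i<M. ts (Suc i) < ts i)"

definition h_max :: "(real \<Rightarrow> real) \<Rightarrow> (real \<Rightarrow> real) \<Rightarrow> nat \<Rightarrow> (nat \<Rightarrow> real) \<Rightarrow> real" where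
  "h_max \<alpha> \<sigma> M ts = Max ((\<lambda>i. lam \<alpha> \<sigma> (ts i) - lam \<alpha> \<sigma> (ts (i - 1))) ` {1..M})"

end

theory Submission
  imports Defs
begin

text \<open>
  In the variable \<open>u = \<lambda>\<^sub>t\<close> the rescaled solution \<open>Y(u) = x\<^sub>t / \<alpha>\<^sub>t\<close> satisfies
  \<open>Y'(u) = - e\<^sup>-\<^sup>u F(u, Y(u))\<close> with \<open>F(u, z) = \<epsilon>(\<alpha>\<^sub>t z, t)\<close>, and the rescaled solvers are
  explicit exponential Runge--Kutta methods for this equation. Expanding the nonlinearity along the
  exact solution in powers of \<open>u - a\<close> and integrating against \<open>e\<^sup>-\<^sup>u\<close> gives local errors of
  order \<open>k + 1\<close>, while the Lipschitz condition bounds the growth of errors over a step of length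
  \<open>h\<close> by \<open>1 + C h\<close>. As the steps add up to \<open>\<lambda>\<^sub>0 - \<lambda>\<^sub>T\<close>, a discrete Gronwall argument gives the
  global order \<open>k\<close>.

  The derivative of \<open>\<lambda>\<close> may vanish, so \<open>t\<^sub>\<lambda>\<close> need not be differentiable. The equation for \<open>Y\<close>
  is therefore obtained by comparing \<open>x\<^sub>t / \<alpha>\<^sub>t\<close> with \<open>G(\<lambda>\<^sub>t)\<close>, where \<open>G\<close> is an antiderivative
  of \<open>- e\<^sup>-\<^sup>u F(u, Y(u))\<close>.
\<close>

subsection \<open>Orders in the step size\<close>

text \<open>
  The bound is required for \<open>a < b\<close> only: the coefficients of the third-order method are quotients
  by \<open>b - a\<close>, which take the junk value \<open>0\<close> at \<open>a = b\<close>.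
\<close>

definition increment_order ::
  "real set \<Rightarrow> nat \<Rightarrow> (real \<Rightarrow> real \<Rightarrow> 'a::real_normed_vector) \<Rightarrow> bool" where
  "increment_order S n r \<longleftrightarrow>
     (\<exists>C\<ge>0. \<forall>a\<in>S. \<forall>b\<in>S. a < b \<longrightarrow> norm (r a b) \<le> C * (b - a) ^ n)"

lemma increment_orderI:
  assumes "0 \<le> C" "\<And>a b. a \<in> S \<Longrightarrow> b \<in> S \<Longrightarrow> a < b \<Longrightarrow> norm (r a b) \<le> C * (b - a) ^ n"
  shows "increment_order S n r"
  using assms unfolding increment_order_def by blast

lemma increment_orderE:
  assumes "increment_order S n r"
  obtains C where "0 \<le> C"
    "\<And>a b. a \<in> S \<Longrightarrow> b \<in> S \<Longrightarrow> a < b \<Longrightarrow> norm (r a b) \<le> C * (b - a) ^ n"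
  using assms unfolding increment_order_def by blast

lemma increment_order_cong:
  assumes "increment_order S n r" "\<And>a b. a \<in> S \<Longrightarrow> b \<in> S \<Longrightarrow> a < b \<Longrightarrow> r' a b = r a b"
  shows "increment_order S n r'"
  using assms unfolding increment_order_def by (metis (no_types, lifting))

lemma increment_order_add:
  assumes "increment_order S n r" "increment_order S n r'"
  shows "increment_order S n (\<lambda>a b. r a b + r' a b)"
proof -
  obtain C where C: "0 \<le> C" "\<And>a b. a \<in> S \<Longrightarrow> b \<in> S \<Longrightarrow> a < b \<Longrightarrow> norm (r a b) \<le> C * (b - a) ^ n"
    using assms(1) by (rule increment_orderE) blast
  obtain D where D: "0 \<le> D" "\<And>a b. a \<in> S \<Longrightarrow> b \<in> S \<Longrightarrow> a < b \<Longrightarrow> norm (r' a b) \<le> D * (b - a) ^ n"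
    using assms(2) by (rule increment_orderE) blast
  show ?thesis
  proof (rule increment_orderI)
    show "0 \<le> C + D" using C D by simp
    show "norm (r a b + r' a b) \<le> (C + D) * (b - a) ^ n" if "a \<in> S" "b \<in> S" "a < b" for a b
      using norm_triangle_ineq[of "r a b" "r' a b"] C(2)[OF that] D(2)[OF that]
      by (simp add: distrib_right)
  qed
qed

lemma increment_order_uminus:
  assumes "increment_order S n r"
  shows "increment_order S n (\<lambda>a b. - r a b)"
  using assms unfolding increment_order_def by simp

lemma increment_order_diff:
  assumes "increment_order S n r" "increment_order S n r'"
  shows "increment_order S n (\<lambda>a b. r a b - r' a b)"
  using increment_order_add[OF assms(1) increment_order_uminus[OF assms(2)]] by simp

lemma increment_order_scaleR:
  assumes "increment_order S m c" "increment_order S n r"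
  shows "increment_order S (m + n) (\<lambda>a b. c a b *\<^sub>R r a b)"
proof -
  obtain C where C: "0 \<le> C" "\<And>a b. a \<in> S \<Longrightarrow> b \<in> S \<Longrightarrow> a < b \<Longrightarrow> norm (c a b) \<le> C * (b - a) ^ m"
    using assms(1) by (rule increment_orderE) blast
  obtain D where D: "0 \<le> D" "\<And>a b. a \<in> S \<Longrightarrow> b \<in> S \<Longrightarrow> a < b \<Longrightarrow> norm (r a b) \<le> D * (b - a) ^ n"
    using assms(2) by (rule increment_orderE) blast
  show ?thesis
  proof (rule increment_orderI)
    show "0 \<le> C * D" using C D by simp
    show "norm (c a b *\<^sub>R r a b) \<le> C * D * (b - a) ^ (m + n)" if "a \<in> S" "b \<in> S" "a < b" for a b
    proof -
      have "norm (c a b *\<^sub>R r a b) \<le> (C * (b - a) ^ m) * (D * (b - a) ^ n)"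
        unfolding norm_scaleR using C(2)[OF that] D(2)[OF that] C(1) that
        by (intro mult_mono) auto
      then show ?thesis by (simp add: power_add mult_ac)
    qed
  qed
qed

lemma increment_order_bounded:
  assumes "bounded (f ` S)"
  shows "increment_order S 0 (\<lambda>a b. f a)"
proof -
  obtain B where "\<And>u. u \<in> S \<Longrightarrow> norm (f u) \<le> B" "0 < B"
    using assms unfolding bounded_pos by auto
  then show ?thesis by (intro increment_orderI[of B]) auto
qed

lemma increment_order_const: "increment_order S 0 (\<lambda>a b. c)"
  by (rule increment_orderI[of "norm c"]) auto

lemma increment_order_increment: "increment_order S 1 (\<lambda>a b. b - a)"
  by (rule increment_orderI[of 1]) auto

lemma increment_order_cmult:
  fixes r :: "real \<Rightarrow> real \<Rightarrow> real"
  assumes "increment_order S n r"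
  shows "increment_order S n (\<lambda>a b. c * r a b)"
  using increment_order_scaleR[OF increment_order_const assms, of c] by simp

lemma increment_order_mult_increment:
  fixes r :: "real \<Rightarrow> real \<Rightarrow> real"
  assumes "increment_order S n r"
  shows "increment_order S (Suc n) (\<lambda>a b. r a b * (b - a))"
  using increment_order_scaleR[OF assms increment_order_increment] by simp

lemma increment_order_divide_increment:
  fixes r :: "real \<Rightarrow> real \<Rightarrow> real"
  assumes "increment_order S (Suc n) r"
  shows "increment_order S n (\<lambda>a b. r a b / (b - a))"
  using assms unfolding increment_order_def
  by (auto simp: divide_simps mult_ac)

lemma intermediate_point:
  fixes a b \<rho> :: real
  assumes "a \<in> {lo..hi}" "b \<in> {lo..hi}" "a < b" "0 \<le> \<rho>" "\<rho> \<le> 1"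
  shows "a + \<rho> * (b - a) \<in> {lo..hi}"
proof -
  have "\<rho> * (b - a) \<le> b - a" "0 \<le> \<rho> * (b - a)"
    using assms by (simp_all add: mult_left_le_one_le)
  then show ?thesis using assms(1,2) unfolding atLeastAtMost_iff by linarith
qed

text \<open>Stage values live at such points. As \<open>\<rho> \<le> 1\<close>, a shorter step only
  shrinks the bound; \<open>0 < \<rho>\<close> keeps the shortened step strict.\<close>

lemma increment_order_intermediate:
  assumes "increment_order {lo..hi} n r" "0 < \<rho>" "\<rho> \<le> 1"
  shows "increment_order {lo..hi} n (\<lambda>a b. r a (a + \<rho> * (b - a)))"
proof -
  obtain C where C: "0 \<le> C"
    "\<And>a b. a \<in> {lo..hi} \<Longrightarrow> b \<in> {lo..hi} \<Longrightarrow> a < b \<Longrightarrow> norm (r a b) \<le> C * (b - a) ^ n"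
    using assms(1) by (rule increment_orderE) blast
  show ?thesis
  proof (rule increment_orderI[OF C(1)])
    fix a b assume ab: "a \<in> {lo..hi}" "b \<in> {lo..hi}" "a < b"
    have le: "\<rho> * (b - a) \<le> b - a" using ab assms by (simp add: mult_left_le_one_le)
    have pos: "0 < \<rho> * (b - a)" using ab assms by simp
    have "norm (r a (a + \<rho> * (b - a))) \<le> C * (\<rho> * (b - a)) ^ n"
      using C(2)[of a "a + \<rho> * (b - a)"] ab le pos by auto
    also have "\<dots> \<le> C * (b - a) ^ n"
      using C(1) le pos by (intro mult_left_mono power_mono) auto
    finally show "norm (r a (a + \<rho> * (b - a))) \<le> C * (b - a) ^ n" .
  qed
qed

text \<open>Integration gains one order, by the mean value inequality. The orders of the weights, of
  the Taylor remainders and of the expansion of the flow all come from here.\<close>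

lemma increment_order_antiderivative:
  assumes r': "increment_order {lo..hi} n r'"
    and deriv: "\<And>a b. a \<in> {lo..hi} \<Longrightarrow> b \<in> {lo..hi} \<Longrightarrow> a \<le> b \<Longrightarrow>
      (r a has_vector_derivative r' a b) (at b within {lo..hi})"
    and zero: "\<And>a. a \<in> {lo..hi} \<Longrightarrow> r a a = 0"
  shows "increment_order {lo..hi} (Suc n) r"
proof -
  obtain C where C: "0 \<le> C"
    "\<And>a b. a \<in> {lo..hi} \<Longrightarrow> b \<in> {lo..hi} \<Longrightarrow> a < b \<Longrightarrow> norm (r' a b) \<le> C * (b - a) ^ n"
    using r' by (rule increment_orderE) blast
  show ?thesis
  proof (rule increment_orderI[OF C(1)])
    fix a b assume ab: "a \<in> {lo..hi}" "b \<in> {lo..hi}" "a < b"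
    then have sub: "{a..b} \<subseteq> {lo..hi}" by auto
    have d: "(r a has_vector_derivative r' a u) (at u within {a..b})" if "u \<in> {a..b}" for u
      by (rule has_vector_derivative_within_subset[OF deriv sub]) (use that ab in auto)
    \<comment> \<open>The derivative bound is frozen at its largest value on \<open>{a..b}\<close>,
      which makes the comparison function linear and keeps the constant \<open>C\<close>.\<close>
    have "norm (r a b - r a a) \<le> C * (b - a) ^ n * b - C * (b - a) ^ n * a"
    proof (rule differentiable_bound_general[where \<phi>' = "\<lambda>_. C * (b - a) ^ n" and f' = "r' a"])
      show "continuous_on {a..b} (r a)"
        using d by (meson continuous_on_eq_continuous_within has_vector_derivative_continuous)
      show "(r a has_vector_derivative r' a u) (at u)" if "a < u" "u < b" for u
        using d[of u] that by (simp add: at_within_Icc_at)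
      show "norm (r' a u) \<le> C * (b - a) ^ n" if "a < u" "u < b" for u
      proof -
        have "norm (r' a u) \<le> C * (u - a) ^ n" using C(2)[of a u] that ab by auto
        also have "\<dots> \<le> C * (b - a) ^ n" using C(1) that by (intro mult_left_mono power_mono) auto
        finally show ?thesis .
      qed
      show "((\<lambda>u. C * (b - a) ^ n * u) has_vector_derivative C * (b - a) ^ n) (at u)" for u
        by (auto intro!: derivative_eq_intros simp: has_real_derivative_iff_has_vector_derivative[symmetric])
    qed (use ab in \<open>auto intro!: continuous_intros\<close>)
    then show "norm (r a b) \<le> C * (b - a) ^ Suc n"
      using zero[OF ab(1)] by (simp add: algebra_simps)
  qed
qed

section \<open>Lipschitz bounds in the state variable\<close>

text \<open>For \<open>n = 1\<close>, applied to \<open>g a b z - z\<close>, this is the stability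
  of a one-step method. For \<open>n = 0\<close> it is a uniform Lipschitz bound, which suffices for
  stages that get multiplied by a weight of order 1.\<close>

definition increment_lipschitz ::
  "real set \<Rightarrow> nat \<Rightarrow> (real \<Rightarrow> real \<Rightarrow> 'a::real_normed_vector \<Rightarrow> 'a) \<Rightarrow> bool" where
  "increment_lipschitz S n g \<longleftrightarrow> (\<exists>C\<ge>0. \<forall>a\<in>S. \<forall>b\<in>S. a < b \<longrightarrow>
     (\<forall>z z'. norm (g a b z - g a b z') \<le> C * (b - a) ^ n * norm (z - z')))"

lemma increment_lipschitzI:
  assumes "0 \<le> C" "\<And>a b z z'. a \<in> S \<Longrightarrow> b \<in> S \<Longrightarrow> a < b \<Longrightarrow>
    norm (g a b z - g a b z') \<le> C * (b - a) ^ n * norm (z - z')"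
  shows "increment_lipschitz S n g"
  using assms unfolding increment_lipschitz_def by blast

lemma increment_lipschitzE:
  assumes "increment_lipschitz S n g"
  obtains C where "0 \<le> C" "\<And>a b z z'. a \<in> S \<Longrightarrow> b \<in> S \<Longrightarrow> a < b \<Longrightarrow>
    norm (g a b z - g a b z') \<le> C * (b - a) ^ n * norm (z - z')"
  using assms unfolding increment_lipschitz_def by blast

lemma increment_lipschitz_ident: "increment_lipschitz S 0 (\<lambda>a b z. z)"
  by (rule increment_lipschitzI[of 1]) auto

lemma increment_lipschitz_add:
  assumes "increment_lipschitz S n g" "increment_lipschitz S n g'"
  shows "increment_lipschitz S n (\<lambda>a b z. g a b z + g' a b z)"
proof -
  obtain C where C: "0 \<le> C" "\<And>a b z z'. a \<in> S \<Longrightarrow> b \<in> S \<Longrightarrow> a < b \<Longrightarrow>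
    norm (g a b z - g a b z') \<le> C * (b - a) ^ n * norm (z - z')"
    using assms(1) by (rule increment_lipschitzE) blast
  obtain D where D: "0 \<le> D" "\<And>a b z z'. a \<in> S \<Longrightarrow> b \<in> S \<Longrightarrow> a < b \<Longrightarrow>
    norm (g' a b z - g' a b z') \<le> D * (b - a) ^ n * norm (z - z')"
    using assms(2) by (rule increment_lipschitzE) blast
  show ?thesis
  proof (rule increment_lipschitzI)
    show "0 \<le> C + D" using C D by simp
    show "norm (g a b z + g' a b z - (g a b z' + g' a b z')) \<le> (C + D) * (b - a) ^ n * norm (z - z')"
      if "a \<in> S" "b \<in> S" "a < b" for a b z z'
      using norm_diff_triangle_ineq[of "g a b z" "g' a b z" "g a b z'" "g' a b z'"]
        C(2)[OF that, of z z'] D(2)[OF that, of z z']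
      by (simp add: distrib_right)
  qed
qed

lemma increment_lipschitz_uminus:
  assumes "increment_lipschitz S n g"
  shows "increment_lipschitz S n (\<lambda>a b z. - g a b z)"
  using assms unfolding increment_lipschitz_def by (simp add: norm_minus_commute)

lemma increment_lipschitz_diff:
  assumes "increment_lipschitz S n g" "increment_lipschitz S n g'"
  shows "increment_lipschitz S n (\<lambda>a b z. g a b z - g' a b z)"
  using increment_lipschitz_add[OF assms(1) increment_lipschitz_uminus[OF assms(2)]] by simp

lemma increment_lipschitz_scaleR:
  assumes "increment_order S m c" "increment_lipschitz S n g"
  shows "increment_lipschitz S (m + n) (\<lambda>a b z. c a b *\<^sub>R g a b z)"
proof -
  obtain C where C: "0 \<le> C" "\<And>a b. a \<in> S \<Longrightarrow> b \<in> S \<Longrightarrow> a < b \<Longrightarrow> norm (c a b) \<le> C * (b - a) ^ m"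
    using assms(1) by (rule increment_orderE) blast
  obtain D where D: "0 \<le> D" "\<And>a b z z'. a \<in> S \<Longrightarrow> b \<in> S \<Longrightarrow> a < b \<Longrightarrow>
    norm (g a b z - g a b z') \<le> D * (b - a) ^ n * norm (z - z')"
    using assms(2) by (rule increment_lipschitzE) blast
  show ?thesis
  proof (rule increment_lipschitzI)
    show "0 \<le> C * D" using C D by simp
    show "norm (c a b *\<^sub>R g a b z - c a b *\<^sub>R g a b z') \<le> C * D * (b - a) ^ (m + n) * norm (z - z')"
      if "a \<in> S" "b \<in> S" "a < b" for a b z z'
    proof -
      have "norm (c a b *\<^sub>R (g a b z - g a b z'))
          \<le> (C * (b - a) ^ m) * (D * (b - a) ^ n * norm (z - z'))"
        unfolding norm_scaleR using C(2)[OF that] D(2)[OF that] C(1) that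
        by (intro mult_mono) auto
      then show ?thesis by (simp add: power_add mult_ac scaleR_right_diff_distrib)
    qed
  qed
qed

lemma increment_lipschitz_scaleR_1:
  assumes "increment_order {lo..hi} 1 c" "increment_lipschitz {lo..hi} 0 g"
  shows "increment_lipschitz {lo..hi} 1 (\<lambda>a b z. c a b *\<^sub>R g a b z)"
  using increment_lipschitz_scaleR[OF assms] by simp

text \<open>Step lengths are bounded on a bounded interval. The absolute value keeps the constant
  nonnegative also when \<open>hi < lo\<close>.\<close>

lemma increment_lipschitz_0:
  assumes "increment_lipschitz {lo..hi} n g"
  shows "increment_lipschitz {lo..hi} 0 g"
proof -
  obtain C where C: "0 \<le> C" "\<And>a b z z'. a \<in> {lo..hi} \<Longrightarrow> b \<in> {lo..hi} \<Longrightarrow> a < b \<Longrightarrow>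
    norm (g a b z - g a b z') \<le> C * (b - a) ^ n * norm (z - z')"
    using assms by (rule increment_lipschitzE) blast
  show ?thesis
  proof (rule increment_lipschitzI[of "C * \<bar>hi - lo\<bar> ^ n"])
    show "norm (g a b z - g a b z') \<le> C * \<bar>hi - lo\<bar> ^ n * (b - a) ^ 0 * norm (z - z')"
      if "a \<in> {lo..hi}" "b \<in> {lo..hi}" "a < b" for a b z z'
    proof -
      have "(b - a) ^ n \<le> \<bar>hi - lo\<bar> ^ n" using that by (intro power_mono) auto
      then have "C * (b - a) ^ n * norm (z - z') \<le> C * \<bar>hi - lo\<bar> ^ n * norm (z - z')"
        using C(1) by (intro mult_right_mono mult_left_mono) auto
      then show ?thesis using C(2)[OF that, of z z'] by simp
    qed
  qed (use C in auto)
qed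

lemma increment_lipschitz_0_of_increment:
  assumes "increment_lipschitz {lo..hi} 1 (\<lambda>a b z. g a b z - z)"
  shows "increment_lipschitz {lo..hi} 0 g"
  using increment_lipschitz_add[OF increment_lipschitz_0[OF assms] increment_lipschitz_ident] by simp

lemma increment_lipschitz_intermediate:
  assumes "increment_lipschitz {lo..hi} 0 g" "0 < \<rho>" "\<rho> \<le> 1"
  shows "increment_lipschitz {lo..hi} 0 (\<lambda>a b. g a (a + \<rho> * (b - a)))"
proof -
  obtain C where C: "0 \<le> C" "\<And>a b z z'. a \<in> {lo..hi} \<Longrightarrow> b \<in> {lo..hi} \<Longrightarrow> a < b \<Longrightarrow>
    norm (g a b z - g a b z') \<le> C * (b - a) ^ 0 * norm (z - z')"
    using assms(1) by (rule increment_lipschitzE) blast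
  show ?thesis
  proof (rule increment_lipschitzI[OF C(1)])
    fix a b z z' assume ab: "a \<in> {lo..hi}" "b \<in> {lo..hi}" "a < b"
    have "a + \<rho> * (b - a) \<in> {lo..hi}" "a < a + \<rho> * (b - a)"
      using intermediate_point[OF ab, of \<rho>] ab assms by simp_all
    then show "norm (g a (a + \<rho> * (b - a)) z - g a (a + \<rho> * (b - a)) z')
        \<le> C * (b - a) ^ 0 * norm (z - z')"
      using C(2)[of a "a + \<rho> * (b - a)" z z'] ab by simp
  qed
qed

subsection \<open>Exponential weights\<close>

text \<open>This is \<open>\<integral> e\<^sup>-\<^sup>u (u - a)\<^sup>n\<^sup>-\<^sup>1 / (n - 1)! du\<close> over \<open>[a, b]\<close> for \<open>n \<ge> 1\<close>.\<close>

definition exp_phi :: "nat \<Rightarrow> real \<Rightarrow> real \<Rightarrow> real" where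
  "exp_phi n a b = exp (- b) * (exp (b - a) - (\<Sum>j<n. (b - a) ^ j / fact j))"

text \<open>Splits off the leading term of a weight. Comparing two consecutive instances shows where
  the leading terms of the numerical and the exact weights cancel.\<close>

lemma exp_phi_rec: "exp_phi n a b = exp_phi (Suc n) a b + exp (- b) * ((b - a) ^ n / fact n)"
  by (simp add: exp_phi_def algebra_simps)

text \<open>Induction by splitting off one term: by the product rule its derivative cancels the
  previous integrand and leaves the next one.\<close>

lemma has_vector_derivative_exp_phi:
  "(exp_phi (Suc n) a has_vector_derivative exp (- b) * ((b - a) ^ n / fact n)) (at b within S)"
proof (induction n)
  case 0
  show ?case unfolding exp_phi_def has_real_derivative_iff_has_vector_derivative[symmetric]
    by (auto intro!: derivative_eq_intros simp: algebra_simps)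
next
  case (Suc n)
  have eq: "exp_phi (Suc (Suc n)) a = (\<lambda>b. exp_phi (Suc n) a b - exp (- b) * ((b - a) ^ Suc n / fact (Suc n)))"
    by (rule ext) (subst exp_phi_rec[of "Suc n"], simp)
  have f: "(fact (Suc n) :: real) = (1 + real n) * fact n" by simp
  show ?case
    unfolding eq has_real_derivative_iff_has_vector_derivative[symmetric]
    using Suc[unfolded has_real_derivative_iff_has_vector_derivative[symmetric]]
    apply (auto intro!: derivative_eq_intros simp: f simp del: fact_Suc power_Suc)
    apply (simp add: divide_simps)
    done
qed

lemma increment_order_exp_phi: "increment_order {lo..hi} (Suc n) (exp_phi (Suc n))"
proof (rule increment_order_antiderivative[OF _ has_vector_derivative_exp_phi])
  show "exp_phi (Suc n) a a = 0" for a
    by (induction n) (simp_all add: exp_phi_def)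
  show "increment_order {lo..hi} n (\<lambda>a b. exp (- b) * ((b - a) ^ n / fact n))"
  proof (rule increment_orderI[of "exp (- lo)"])
    fix a b assume ab: "a \<in> {lo..hi}" "b \<in> {lo..hi}" "a < b"
    have "(b - a) ^ n / fact n \<le> (b - a) ^ n"
      using ab by (simp add: divide_le_eq mult_le_cancel_left1 fact_ge_1)
    moreover have "exp (- b) \<le> exp (- lo)" using ab by simp
    ultimately have "exp (- b) * ((b - a) ^ n / fact n) \<le> exp (- lo) * (b - a) ^ n"
      using ab by (intro mult_mono) auto
    then show "norm (exp (- b) * ((b - a) ^ n / fact n)) \<le> exp (- lo) * (b - a) ^ n"
      using ab by (simp add: abs_mult)
  qed simp
qed


lemma exp_phi_orders:
  "increment_order {lo..hi} 1 (exp_phi 1)"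
  "increment_order {lo..hi} 2 (exp_phi 2)"
  "increment_order {lo..hi} 1 (\<lambda>a b. c * (exp_phi 2 a b / (b - a)))"
  "increment_order {lo..hi} 3 (exp_phi 3)"
  "increment_order {lo..hi} 4 (exp_phi 4)"
proof -
  show 2: "increment_order {lo..hi} 2 (exp_phi 2)"
    using increment_order_exp_phi[of lo hi 1] by (simp add: numeral_2_eq_2)
  show "increment_order {lo..hi} 1 (\<lambda>a b. c * (exp_phi 2 a b / (b - a)))"
    using 2 by (intro increment_order_cmult increment_order_divide_increment) (simp add: numeral_2_eq_2)
qed (use increment_order_exp_phi[of lo hi 0] increment_order_exp_phi[of lo hi 2]
      increment_order_exp_phi[of lo hi 3] in \<open>simp_all add: eval_nat_numeral\<close>)

subsection \<open>Convergence of one-step methods\<close>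

text \<open>Discrete Gronwall argument. Error growth is measured by the length covered,
  \<open>us i - lo\<close>, and not by the number of steps, so the constant is the same for all
  \<open>M\<close> and all grids.\<close>

lemma one_step_method_convergence:
  fixes Y :: "real \<Rightarrow> 'a::real_normed_vector"
  assumes stable: "increment_lipschitz {lo..hi} 1 (\<lambda>a b z. \<Phi> a b z - z)"
    and consistent: "increment_order {lo..hi} (Suc k) (\<lambda>a b. \<Phi> a b (Y a) - Y b)"
  obtains C where "0 \<le> C"
    "\<And>M us zs H. us 0 = lo \<Longrightarrow> us M = hi \<Longrightarrow> zs 0 = Y lo \<Longrightarrow>
       (\<And>i. i \<le> M \<Longrightarrow> us i \<in> {lo..hi}) \<Longrightarrow>
       (\<And>i. i < M \<Longrightarrow> us i < us (Suc i)) \<Longrightarrow> (\<And>i. i < M \<Longrightarrow> us (Suc i) - us i \<le> H) \<Longrightarrow>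
       (\<And>i. i < M \<Longrightarrow> zs (Suc i) = \<Phi> (us i) (us (Suc i)) (zs i)) \<Longrightarrow>
       norm (zs M - Y hi) \<le> C * H ^ k"
proof -
  obtain K where K: "0 \<le> K" "\<And>a b z z'. a \<in> {lo..hi} \<Longrightarrow> b \<in> {lo..hi} \<Longrightarrow> a < b \<Longrightarrow>
    norm ((\<Phi> a b z - z) - (\<Phi> a b z' - z')) \<le> K * (b - a) ^ 1 * norm (z - z')"
    using stable by (rule increment_lipschitzE) blast
  obtain B where B: "0 \<le> B" "\<And>a b. a \<in> {lo..hi} \<Longrightarrow> b \<in> {lo..hi} \<Longrightarrow> a < b \<Longrightarrow>
    norm (\<Phi> a b (Y a) - Y b) \<le> B * (b - a) ^ Suc k"
    using consistent by (rule increment_orderE) blast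
  show ?thesis
  proof (rule that[of "exp (K * \<bar>hi - lo\<bar>) * B * \<bar>hi - lo\<bar>"])
    fix M :: nat and us :: "nat \<Rightarrow> real" and zs and H :: real
    assume us: "us 0 = lo" "us M = hi" "\<And>i. i \<le> M \<Longrightarrow> us i \<in> {lo..hi}"
        "\<And>i. i < M \<Longrightarrow> us i < us (Suc i)" "\<And>i. i < M \<Longrightarrow> us (Suc i) - us i \<le> H"
      and zs: "zs 0 = Y lo" "\<And>i. i < M \<Longrightarrow> zs (Suc i) = \<Phi> (us i) (us (Suc i)) (zs i)"
    have "norm (zs i - Y (us i)) \<le> exp (K * (us i - lo)) * (B * H ^ k) * (us i - lo)" if "i \<le> M" for i
      using that
    proof (induction i)
      case 0
      then show ?case using us zs by simp
    next
      case (Suc i)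
      define h where "h = us (Suc i) - us i"
      have h: "0 < h" "h \<le> H" and in_S: "us i \<in> {lo..hi}" "us (Suc i) \<in> {lo..hi}"
        using us(3)[of i] us(3)[of "Suc i"] us(4,5)[of i] Suc.prems by (auto simp: h_def)
      have lt: "us i < us (Suc i)" using us(4) Suc.prems by simp
      define q where "q = B * H ^ k"
      have q: "0 \<le> q" using B(1) h by (simp add: q_def)
      have exp_eq: "exp (K * (us (Suc i) - lo)) = exp (K * h) * exp (K * (us i - lo))"
        unfolding mult_exp_exp by (simp add: h_def distrib_left[symmetric])
      have e1: "1 \<le> exp (K * (us (Suc i) - lo))" using K(1) in_S by simp
      \<comment> \<open>Three contributions: the old error, the difference of the increments at the
        computed and the exact value (stability), and the local error (consistency).\<close>
      have "zs (Suc i) - Y (us (Suc i)) = (zs i - Y (us i))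
          + ((\<Phi> (us i) (us (Suc i)) (zs i) - zs i) - (\<Phi> (us i) (us (Suc i)) (Y (us i)) - Y (us i)))
          + (\<Phi> (us i) (us (Suc i)) (Y (us i)) - Y (us (Suc i)))"
        using zs(2)[of i] Suc.prems by simp
      also have "norm \<dots> \<le> norm (zs i - Y (us i)) + K * h * norm (zs i - Y (us i)) + B * h ^ Suc k"
        using K(2)[OF in_S lt, of "zs i" "Y (us i)"] B(2)[OF in_S lt]
        by (intro order_trans[OF norm_triangle_ineq] add_mono) (simp_all add: h_def)
      also have "\<dots> = (1 + K * h) * norm (zs i - Y (us i)) + B * h ^ k * h"
        by (simp add: algebra_simps)
      also have "\<dots> \<le> exp (K * h) * (exp (K * (us i - lo)) * q * (us i - lo))
          + exp (K * (us (Suc i) - lo)) * q * h"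
      proof (rule add_mono)
        show "(1 + K * h) * norm (zs i - Y (us i)) \<le> exp (K * h) * (exp (K * (us i - lo)) * q * (us i - lo))"
          using Suc h K(1) exp_ge_add_one_self[of "K * h"] by (intro mult_mono) (auto simp: q_def)
        \<comment> \<open>The local error is enlarged by a factor of at least 1 so that it shares
          the exponential of the propagated error; the lengths \<open>us i - lo\<close> and
          \<open>h\<close> then add up.\<close>
        have "B * h ^ k \<le> q" unfolding q_def using B(1) h by (intro mult_left_mono power_mono) auto
        also have "q \<le> exp (K * (us (Suc i) - lo)) * q" using mult_right_mono[OF e1 q] by simp
        finally show "B * h ^ k * h \<le> exp (K * (us (Suc i) - lo)) * q * h"
          using h by (intro mult_right_mono) auto
      qed
      also have "exp (K * h) * (exp (K * (us i - lo)) * q * (us i - lo))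
          = exp (K * (us (Suc i) - lo)) * q * (us i - lo)"
        unfolding exp_eq by (simp only: mult.assoc)
      also have "\<dots> + exp (K * (us (Suc i) - lo)) * q * h
          = exp (K * (us (Suc i) - lo)) * q * (us (Suc i) - lo)"
        unfolding h_def by (simp only: distrib_left[symmetric]) simp
      finally show ?case unfolding q_def .
    qed
    from this[of M] us(1,2) us(3)[of 0]
    show "norm (zs M - Y hi) \<le> exp (K * \<bar>hi - lo\<bar>) * B * \<bar>hi - lo\<bar> * H ^ k"
      by (simp add: mult_ac)
  qed (use B in simp)
qed

subsection \<open>Exponential Runge--Kutta steps\<close>

text \<open>Stability of the steps rests on the Lipschitz bound alone; the exact solution enters
  only with consistency.\<close>

locale semilinear_flow =
  fixes lo hi :: real and F :: "real \<Rightarrow> 'a::real_normed_vector \<Rightarrow> 'a" and K :: real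
  assumes K_nonneg: "0 \<le> K"
    and lipschitz: "u \<in> {lo..hi} \<Longrightarrow> norm (F u z - F u z') \<le> K * norm (z - z')"
begin

text \<open>Exponential Euler: the nonlinearity is frozen at \<open>a\<close> and the weight
  \<open>exp (- u)\<close> is integrated exactly.\<close>

definition step1 :: "real \<Rightarrow> real \<Rightarrow> 'a \<Rightarrow> 'a" where
  "step1 a b z = z - exp_phi 1 a b *\<^sub>R F a z"

text \<open>Exponential midpoint rule with an Euler predictor.\<close>

definition step2 :: "real \<Rightarrow> real \<Rightarrow> 'a \<Rightarrow> 'a" where
  "step2 a b z = (let m = a + 1/2 * (b - a) in z - exp_phi 1 a b *\<^sub>R F m (step1 a m z))"

text \<open>
  The stage of the third-order method at the node \<open>2/3\<close>, as a step in its own right: the node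
  \<open>1/3\<close> is the midpoint of the interval that it covers.
\<close>

definition stage3 :: "real \<Rightarrow> real \<Rightarrow> 'a \<Rightarrow> 'a" where
  "stage3 a b z = (let m = a + 1/2 * (b - a) in z - exp_phi 1 a b *\<^sub>R F a z
     - (2 * (exp_phi 2 a b / (b - a))) *\<^sub>R (F m (step1 a m z) - F a z))"

text \<open>The nonlinearity is replaced by its linear interpolant at \<open>a\<close> and
  \<open>s\<close>, integrated exactly against \<open>exp (- u)\<close>. The factor
  \<open>3/2\<close> is the reciprocal of the node, just as \<open>2\<close> is in
  \<open>stage3\<close>.\<close>

definition step3 :: "real \<Rightarrow> real \<Rightarrow> 'a \<Rightarrow> 'a" where
  "step3 a b z = (let s = a + 2/3 * (b - a) in z - exp_phi 1 a b *\<^sub>R F a z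
     - (3/2 * (exp_phi 2 a b / (b - a))) *\<^sub>R (F s (stage3 a s z) - F a z))"

text \<open>The case \<open>\<rho> = 0\<close> is included to cover evaluation at the left end
  point.\<close>

lemma increment_lipschitz_F:
  assumes g: "increment_lipschitz {lo..hi} 0 g" and "0 \<le> \<rho>" "\<rho> \<le> 1"
  shows "increment_lipschitz {lo..hi} 0 (\<lambda>a b z. F (a + \<rho> * (b - a)) (g a b z))"
proof -
  obtain C where C: "0 \<le> C" "\<And>a b z z'. a \<in> {lo..hi} \<Longrightarrow> b \<in> {lo..hi} \<Longrightarrow> a < b \<Longrightarrow>
    norm (g a b z - g a b z') \<le> C * (b - a) ^ 0 * norm (z - z')"
    using g by (rule increment_lipschitzE) blast
  show ?thesis
  proof (rule increment_lipschitzI[of "K * C"])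
    fix a b z z' assume ab: "a \<in> {lo..hi}" "b \<in> {lo..hi}" "a < b"
    have "norm (F (a + \<rho> * (b - a)) (g a b z) - F (a + \<rho> * (b - a)) (g a b z'))
        \<le> K * norm (g a b z - g a b z')"
      using assms by (intro lipschitz intermediate_point[OF ab])
    also have "\<dots> \<le> K * (C * norm (z - z'))"
      using C(2)[OF ab, of z z'] K_nonneg by (intro mult_left_mono) auto
    finally show "norm (F (a + \<rho> * (b - a)) (g a b z) - F (a + \<rho> * (b - a)) (g a b z'))
        \<le> K * C * (b - a) ^ 0 * norm (z - z')"
      by (simp add: mult.assoc)
  qed (use C K_nonneg in simp)
qed

lemma increment_lipschitz_F_start: "increment_lipschitz {lo..hi} 0 (\<lambda>a b z. F a z)"
  using increment_lipschitz_F[OF increment_lipschitz_ident, of 0] by simp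

text \<open>The increment is a weight of order 1 times a Lipschitz map; the other stability proofs
  follow the same pattern.\<close>

lemma step1_stable: "increment_lipschitz {lo..hi} 1 (\<lambda>a b z. step1 a b z - z)"
  unfolding step1_def
  using increment_lipschitz_uminus[OF increment_lipschitz_scaleR_1[OF exp_phi_orders(1)
      increment_lipschitz_F_start]] by simp

lemma step1_midpoint_lipschitz:
  "increment_lipschitz {lo..hi} 0 (\<lambda>a b z. F (a + 1/2 * (b - a)) (step1 a (a + 1/2 * (b - a)) z))"
  by (intro increment_lipschitz_F increment_lipschitz_intermediate[where g = step1]
      increment_lipschitz_0_of_increment step1_stable) auto

lemma step2_stable: "increment_lipschitz {lo..hi} 1 (\<lambda>a b z. step2 a b z - z)"
  unfolding step2_def
  using increment_lipschitz_uminus[OF increment_lipschitz_scaleR_1[OF exp_phi_orders(1)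
      step1_midpoint_lipschitz]] by (simp add: Let_def)

lemma stage3_stable: "increment_lipschitz {lo..hi} 1 (\<lambda>a b z. stage3 a b z - z)"
proof -
  have "increment_lipschitz {lo..hi} 1 (\<lambda>a b z. - (exp_phi 1 a b *\<^sub>R F a z)
     - (2 * (exp_phi 2 a b / (b - a))) *\<^sub>R (F (a + 1/2 * (b - a)) (step1 a (a + 1/2 * (b - a)) z) - F a z))"
    by (intro increment_lipschitz_diff increment_lipschitz_uminus increment_lipschitz_scaleR_1
        exp_phi_orders increment_lipschitz_F_start step1_midpoint_lipschitz)
  then show ?thesis by (simp add: stage3_def Let_def)
qed

lemma step3_stable: "increment_lipschitz {lo..hi} 1 (\<lambda>a b z. step3 a b z - z)"
proof -
  have stage: "increment_lipschitz {lo..hi} 0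
      (\<lambda>a b z. F (a + 2/3 * (b - a)) (stage3 a (a + 2/3 * (b - a)) z))"
    by (rule increment_lipschitz_F[OF increment_lipschitz_intermediate[where g = stage3,
          OF increment_lipschitz_0_of_increment[OF stage3_stable]]]) auto
  have "increment_lipschitz {lo..hi} 1 (\<lambda>a b z. - (exp_phi 1 a b *\<^sub>R F a z)
     - (3/2 * (exp_phi 2 a b / (b - a))) *\<^sub>R (F (a + 2/3 * (b - a)) (stage3 a (a + 2/3 * (b - a)) z) - F a z))"
    by (intro increment_lipschitz_diff increment_lipschitz_uminus increment_lipschitz_scaleR_1
        exp_phi_orders increment_lipschitz_F_start increment_lipschitz_F
        increment_lipschitz_intermediate[where g = stage3]
        increment_lipschitz_0_of_increment stage3_stable) auto
  then show ?thesis by (simp add: step3_def Let_def)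
qed

end


section \<open>Consistency along a smooth solution\<close>

text \<open>The \<open>d j\<close> are total derivatives of \<open>F u (Y u)\<close> along the
  solution, so no partial derivatives of \<open>F\<close> appear.\<close>

locale smooth_semilinear_flow = semilinear_flow lo hi F K
  for lo hi :: real and F :: "real \<Rightarrow> 'a::real_normed_vector \<Rightarrow> 'a" and K :: real +
  fixes Y :: "real \<Rightarrow> 'a" and d :: "nat \<Rightarrow> real \<Rightarrow> 'a" and N :: nat
  assumes Y_deriv: "u \<in> {lo..hi} \<Longrightarrow>
      (Y has_vector_derivative - (exp (- u) *\<^sub>R d 0 u)) (at u within {lo..hi})"
    and d_0: "u \<in> {lo..hi} \<Longrightarrow> d 0 u = F u (Y u)"
    and d_deriv: "j < N \<Longrightarrow> u \<in> {lo..hi} \<Longrightarrow>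
      (d j has_vector_derivative d (Suc j) u) (at u within {lo..hi})"
    and d_cont: "j \<le> N \<Longrightarrow> continuous_on {lo..hi} (d j)"
begin

lemma bounded_d: "j \<le> N \<Longrightarrow> bounded (d j ` {lo..hi})"
  by (intro compact_imp_bounded compact_continuous_image d_cont) auto

text \<open>Differentiating the remainder in \<open>b\<close> gives the remainder with one term less
  for \<open>d (Suc i)\<close>; hence the induction generalizes over \<open>i\<close>.\<close>

lemma taylor_order:
  assumes "i + n \<le> N"
  shows "increment_order {lo..hi} n (\<lambda>a b. d i b - (\<Sum>j<n. ((b - a) ^ j / fact j) *\<^sub>R d (i + j) a))"
  using assms
proof (induction n arbitrary: i)
  case 0
  then obtain B where "0 < B" "\<forall>v\<in>d i ` {lo..hi}. norm v \<le> B"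
    using bounded_d[of i] unfolding bounded_pos by auto
  then show ?case by (intro increment_orderI[of B]) auto
next
  case (Suc n)
  have "((\<lambda>b. d i b - (\<Sum>j<Suc n. ((b - a) ^ j / fact j) *\<^sub>R d (i + j) a)) has_vector_derivative
      d (Suc i) b - (\<Sum>j<n. ((b - a) ^ j / fact j) *\<^sub>R d (Suc i + j) a)) (at b within {lo..hi})"
    if "b \<in> {lo..hi}" for a b
  proof -
    have "((\<lambda>b. ((b - a) ^ Suc j / fact (Suc j)) *\<^sub>R d (i + Suc j) a) has_vector_derivative
        ((b - a) ^ j / fact j) *\<^sub>R d (Suc i + j) a) (at b within {lo..hi})" for j
    proof -
      have "((\<lambda>b. (b - a) ^ Suc j / fact (Suc j)) has_real_derivative (b - a) ^ j / fact j)
          (at b within {lo..hi})"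
      proof -
        have "((\<lambda>b. (b - a) ^ Suc j / fact (Suc j)) has_real_derivative
            (1 + real j) * (b - a) ^ j / fact (Suc j)) (at b within {lo..hi})"
          by (auto intro!: derivative_eq_intros simp del: fact_Suc power_Suc)
        moreover have "(1 + real j) * (b - a) ^ j / fact (Suc j) = (b - a) ^ j / fact j"
          by (simp add: divide_simps)
        ultimately show ?thesis by simp
      qed
      from has_vector_derivative_scaleR[OF this has_vector_derivative_const[of "d (i + Suc j) a"]]
      show ?thesis by simp
    qed
    then have "((\<lambda>b. \<Sum>j<n. ((b - a) ^ Suc j / fact (Suc j)) *\<^sub>R d (i + Suc j) a) has_vector_derivative
        (\<Sum>j<n. ((b - a) ^ j / fact j) *\<^sub>R d (Suc i + j) a)) (at b within {lo..hi})"
      by (intro has_vector_derivative_sum)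
    \<comment> \<open>The term \<open>j = 0\<close> is constant in \<open>b\<close> and drops out;
      the other terms move down by one index.\<close>
    from has_vector_derivative_diff[OF has_vector_derivative_diff[OF d_deriv[of i b]
          has_vector_derivative_const[of "d i a"]] this]
    show ?thesis using that Suc.prems
      unfolding sum.lessThan_Suc_shift by (simp add: diff_diff_eq del: power_Suc fact_Suc)
  qed
  moreover have "increment_order {lo..hi} n
      (\<lambda>a b. d (Suc i) b - (\<Sum>j<n. ((b - a) ^ j / fact j) *\<^sub>R d (Suc i + j) a))"
    using Suc.IH[of "Suc i"] Suc.prems by simp
  moreover have "d i a - (\<Sum>j<Suc n. ((a - a) ^ j / fact j) *\<^sub>R d (i + j) a) = 0" for a
    by (simp add: sum.lessThan_Suc_shift del: sum.lessThan_Suc)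
  ultimately show ?case by (intro increment_order_antiderivative)
qed

text \<open>The derivative in \<open>b\<close> is \<open>- exp (- b)\<close> times the Taylor
  remainder of \<open>d 0\<close>, and integration gains one order. This is the exact solution
  against which the steps are compared.\<close>

lemma flow_order:
  assumes "n \<le> N"
  shows "increment_order {lo..hi} (Suc n)
    (\<lambda>a b. Y b - Y a + (\<Sum>j<n. exp_phi (Suc j) a b *\<^sub>R d j a))"
proof (rule increment_order_antiderivative)
  let ?T = "\<lambda>a b. d 0 b - (\<Sum>j<n. ((b - a) ^ j / fact j) *\<^sub>R d j a)"
  have "increment_order {lo..hi} 0 (\<lambda>a b. - exp (- b))"
    by (rule increment_orderI[of "exp (- lo)"]) auto
  from increment_order_scaleR[OF this taylor_order[of 0 n]] assms
  show "increment_order {lo..hi} n (\<lambda>a b. (- exp (- b)) *\<^sub>R ?T a b)" by simp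
  show "((\<lambda>b. Y b - Y a + (\<Sum>j<n. exp_phi (Suc j) a b *\<^sub>R d j a)) has_vector_derivative
      (- exp (- b)) *\<^sub>R ?T a b) (at b within {lo..hi})" if "b \<in> {lo..hi}" for a b
  proof -
    have "((\<lambda>b. exp_phi (Suc j) a b *\<^sub>R d j a) has_vector_derivative
        exp (- b) *\<^sub>R (((b - a) ^ j / fact j) *\<^sub>R d j a)) (at b within {lo..hi})" for j
      using has_vector_derivative_scaleR[OF
          has_vector_derivative_exp_phi[folded has_real_derivative_iff_has_vector_derivative]
          has_vector_derivative_const[of "d j a"]] by simp
    then have "((\<lambda>b. \<Sum>j<n. exp_phi (Suc j) a b *\<^sub>R d j a) has_vector_derivative
        (\<Sum>j<n. exp (- b) *\<^sub>R (((b - a) ^ j / fact j) *\<^sub>R d j a))) (at b within {lo..hi})"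
      by (intro has_vector_derivative_sum)
    from has_vector_derivative_add[OF has_vector_derivative_diff[OF Y_deriv[OF that]
          has_vector_derivative_const[of "Y a"]] this]
    show ?thesis by (simp add: scaleR_sum_right scaleR_right_diff_distrib sum_negf)
  qed
  show "Y a - Y a + (\<Sum>j<n. exp_phi (Suc j) a a *\<^sub>R d j a) = 0" for a
  proof -
    have "exp_phi (Suc j) a a = 0" for j by (induction j) (simp_all add: exp_phi_def)
    then show ?thesis by simp
  qed
qed

text \<open>By the Lipschitz bound, evaluating \<open>F\<close> at an approximate stage value keeps
  the order of the stage error.\<close>

lemma F_perturbation:
  assumes w: "increment_order {lo..hi} n (\<lambda>a b. w a (a + \<rho> * (b - a)) - Y (a + \<rho> * (b - a)))"
    and \<rho>: "0 < \<rho>" "\<rho> \<le> 1"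
  shows "increment_order {lo..hi} n
    (\<lambda>a b. F (a + \<rho> * (b - a)) (w a (a + \<rho> * (b - a))) - d 0 (a + \<rho> * (b - a)))"
proof -
  obtain C where C: "0 \<le> C" "\<And>a b. a \<in> {lo..hi} \<Longrightarrow> b \<in> {lo..hi} \<Longrightarrow> a < b \<Longrightarrow>
      norm (w a (a + \<rho> * (b - a)) - Y (a + \<rho> * (b - a))) \<le> C * (b - a) ^ n"
    using w by (rule increment_orderE) blast
  show ?thesis
  proof (rule increment_orderI[of "K * C"])
    fix a b assume ab: "a \<in> {lo..hi}" "b \<in> {lo..hi}" "a < b"
    let ?s = "a + \<rho> * (b - a)"
    have s: "?s \<in> {lo..hi}" using intermediate_point[OF ab] \<rho> by simp
    have "norm (F ?s (w a ?s) - d 0 ?s) \<le> K * norm (w a ?s - Y ?s)"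
      unfolding d_0[OF s] by (rule lipschitz[OF s])
    also have "\<dots> \<le> K * (C * (b - a) ^ n)"
      using C(2)[OF ab] K_nonneg by (rule mult_left_mono)
    finally show "norm (F ?s (w a ?s) - d 0 ?s) \<le> K * C * (b - a) ^ n" by (simp add: mult.assoc)
  qed (use C K_nonneg in simp)
qed

text \<open>The local error is exactly the negative of the remainder of the flow expansion with one
  term.\<close>

lemma step1_consistent:
  assumes "1 \<le> N"
  shows "increment_order {lo..hi} 2 (\<lambda>a b. step1 a b (Y a) - Y b)"
  by (rule increment_order_cong[OF increment_order_uminus[OF flow_order[OF assms, unfolded numeral_2_eq_2[symmetric] Suc_1]]])
     (simp add: step1_def d_0)

lemma step1_midpoint_error:
  assumes "1 \<le> N"
  shows "increment_order {lo..hi} 2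
    (\<lambda>a b. F (a + 1/2 * (b - a)) (step1 a (a + 1/2 * (b - a)) (Y a)) - d 0 (a + 1/2 * (b - a)))"
  using increment_order_intermediate[OF step1_consistent[OF assms], of "1/2"]
  by (intro F_perturbation) auto

text \<open>The local error splits into the stage error \<open>G\<close>, the Taylor remainder
  \<open>E\<close> at the midpoint, a mismatch \<open>c\<close> in the coefficient of
  \<open>d 1\<close>, and the flow remainder \<open>R\<close>. The weight \<open>exp_phi 1\<close>
  supplies the order that \<open>E\<close> and \<open>G\<close> are short of.\<close>

lemma step2_consistent:
  assumes "2 \<le> N"
  shows "increment_order {lo..hi} 3 (\<lambda>a b. step2 a b (Y a) - Y b)"
proof -
  define m where "m = (\<lambda>a b :: real. a + 1/2 * (b - a))"
  define G where "G = (\<lambda>a b. F (m a b) (step1 a (m a b) (Y a)) - d 0 (m a b))"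
  define E where "E = (\<lambda>a b. d 0 (m a b) - d 0 a - (1/2 * (b - a)) *\<^sub>R d 1 a)"
  define R where "R = (\<lambda>a b. Y b - Y a + exp_phi 1 a b *\<^sub>R d 0 a + exp_phi 2 a b *\<^sub>R d 1 a)"
  \<comment> \<open>The method has \<open>\<phi>\<^sub>1 h/2\<close> where the exact solution has \<open>\<phi>\<^sub>2\<close>; \<open>c\<close> is the difference.\<close>
  define c where "c = (\<lambda>a b. 1/2 * (exp_phi 2 a b * (b - a)) - exp_phi 3 a b)"
  have G: "increment_order {lo..hi} 2 G"
    using step1_midpoint_error assms unfolding G_def m_def by simp
  have E: "increment_order {lo..hi} 2 E"
    using increment_order_intermediate[OF taylor_order[of 0 2], of "1/2"] assms
    unfolding E_def m_def by (simp add: numeral_2_eq_2 diff_diff_eq)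
  have R: "increment_order {lo..hi} 3 R"
    using flow_order[of 2] assms unfolding R_def by (simp add: eval_nat_numeral add_ac)
  have c: "increment_order {lo..hi} 3 c"
    unfolding c_def
    using increment_order_mult_increment[OF exp_phi_orders(2)]
    by (intro increment_order_diff increment_order_cmult exp_phi_orders(4)) simp
  have "increment_order {lo..hi} 3
      (\<lambda>a b. - (exp_phi 1 a b *\<^sub>R (E a b + G a b)) - c a b *\<^sub>R d 1 a - R a b)"
    using increment_order_scaleR[OF exp_phi_orders(1) increment_order_add[OF E G]]
      increment_order_scaleR[OF c increment_order_bounded[OF bounded_d[of 1]]] assms
    by (intro increment_order_diff increment_order_uminus R) (simp_all add: numeral_3_eq_3)
  then show ?thesis
  proof (rule increment_order_cong)
    fix a b assume ab: "a \<in> {lo..hi}" "b \<in> {lo..hi}" "a < b"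
    have phi_eq: "exp_phi 1 a b = exp_phi 2 a b + exp (- b) * (b - a)"
      "exp_phi 2 a b = exp_phi 3 a b + exp (- b) * ((b - a) ^ 2 / 2)"
      using exp_phi_rec[of 1 a b] exp_phi_rec[of 2 a b]
      by (simp_all add: numeral_2_eq_2 numeral_3_eq_3)
    \<comment> \<open>Both products on the right have order 2 only; their leading terms
      \<open>e * h ^ 2 / 2\<close> cancel because the node is the midpoint.\<close>
    have "1/2 * (p2 * h) - p3 = p1 * (1/2 * h) - p2"
      if "p1 = p2 + e * h" "p2 = p3 + e * (h ^ 2 / 2)" for p1 p2 p3 e h :: real
      unfolding that by (simp add: field_simps power2_eq_square)
    from this[OF phi_eq] have cc: "c a b = exp_phi 1 a b * (1/2 * (b - a)) - exp_phi 2 a b"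
      unfolding c_def .
    have "step2 a b (Y a) - Y b
      = Y a - exp_phi 1 a b *\<^sub>R (G a b + E a b + d 0 a + (1/2 * (b - a)) *\<^sub>R d 1 a) - Y b"
      by (simp add: step2_def Let_def m_def G_def E_def)
    then show "step2 a b (Y a) - Y b = - (exp_phi 1 a b *\<^sub>R (E a b + G a b)) - c a b *\<^sub>R d 1 a - R a b"
      unfolding cc R_def scaleR_right_distrib scaleR_left_diff_distrib scaleR_scaleR
      by (simp add: algebra_simps)
  qed
qed

text \<open>The interpolation weight \<open>q\<close> reproduces the coefficient of
  \<open>d 1\<close> exactly, so no mismatch term arises; being of order 1, it raises the order 2 of
  \<open>E\<close> and \<open>G\<close> to 3.\<close>

lemma stage3_consistent:
  assumes "2 \<le> N"
  shows "increment_order {lo..hi} 3 (\<lambda>a b. stage3 a b (Y a) - Y b)"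
proof -
  define m where "m = (\<lambda>a b :: real. a + 1/2 * (b - a))"
  define G where "G = (\<lambda>a b. F (m a b) (step1 a (m a b) (Y a)) - d 0 (m a b))"
  define E where "E = (\<lambda>a b. d 0 (m a b) - d 0 a - (1/2 * (b - a)) *\<^sub>R d 1 a)"
  define R where "R = (\<lambda>a b. Y b - Y a + exp_phi 1 a b *\<^sub>R d 0 a + exp_phi 2 a b *\<^sub>R d 1 a)"
  define q where "q = (\<lambda>a b. 2 * (exp_phi 2 a b / (b - a)))"
  have G: "increment_order {lo..hi} 2 G"
    using step1_midpoint_error assms unfolding G_def m_def by simp
  have E: "increment_order {lo..hi} 2 E"
    using increment_order_intermediate[OF taylor_order[of 0 2], of "1/2"] assms
    unfolding E_def m_def by (simp add: numeral_2_eq_2 diff_diff_eq)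
  have R: "increment_order {lo..hi} 3 R"
    using flow_order[of 2] assms unfolding R_def by (simp add: eval_nat_numeral add_ac)
  have "increment_order {lo..hi} 3 (\<lambda>a b. - (q a b *\<^sub>R (E a b + G a b)) - R a b)"
    using increment_order_scaleR[OF exp_phi_orders(3)[where c = 2] increment_order_add[OF E G]]
    unfolding q_def by (intro increment_order_diff increment_order_uminus R) (simp add: numeral_3_eq_3)
  then show ?thesis
  proof (rule increment_order_cong)
    fix a b assume ab: "a \<in> {lo..hi}" "b \<in> {lo..hi}" "a < b"
    have qq: "q a b * (1/2 * (b - a)) = exp_phi 2 a b"
      using ab by (simp add: q_def)
    have "stage3 a b (Y a) - Y b
      = Y a - exp_phi 1 a b *\<^sub>R d 0 a - q a b *\<^sub>R (G a b + E a b + (1/2 * (b - a)) *\<^sub>R d 1 a) - Y b"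
      using ab by (simp add: stage3_def Let_def m_def G_def E_def q_def d_0)
    then show "stage3 a b (Y a) - Y b = - (q a b *\<^sub>R (E a b + G a b)) - R a b"
      unfolding R_def scaleR_right_distrib scaleR_scaleR qq by (simp add: algebra_simps)
  qed
qed

text \<open>As for \<open>stage3\<close>, the coefficient of \<open>d 1\<close> is exact. That of
  \<open>d 2\<close> agrees with \<open>exp_phi 3\<close> up to order 4, thanks to the node
  \<open>2/3\<close>.\<close>

lemma step3_consistent:
  assumes "3 \<le> N"
  shows "increment_order {lo..hi} 4 (\<lambda>a b. step3 a b (Y a) - Y b)"
proof -
  define s where "s = (\<lambda>a b :: real. a + 2/3 * (b - a))"
  define G where "G = (\<lambda>a b. F (s a b) (stage3 a (s a b) (Y a)) - d 0 (s a b))"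
  define E where "E = (\<lambda>a b. d 0 (s a b) - d 0 a - (2/3 * (b - a)) *\<^sub>R d 1 a
    - ((2/3 * (b - a)) ^ 2 / 2) *\<^sub>R d 2 a)"
  define R where "R = (\<lambda>a b. Y b - Y a + exp_phi 1 a b *\<^sub>R d 0 a + exp_phi 2 a b *\<^sub>R d 1 a
    + exp_phi 3 a b *\<^sub>R d 2 a)"
  define q where "q = (\<lambda>a b. 3/2 * (exp_phi 2 a b / (b - a)))"
  \<comment> \<open>The method has \<open>\<phi>\<^sub>2 h/3\<close> where the exact solution has \<open>\<phi>\<^sub>3\<close>; \<open>c\<close> is the difference.\<close>
  define c where "c = (\<lambda>a b. 1/3 * (exp_phi 3 a b * (b - a)) - exp_phi 4 a b)"
  have G: "increment_order {lo..hi} 3 G"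
    using increment_order_intermediate[OF stage3_consistent, of "2/3"] assms
    unfolding G_def s_def by (intro F_perturbation) auto
  have E: "increment_order {lo..hi} 3 E"
    using increment_order_intermediate[OF taylor_order[of 0 3], of "2/3"] assms
    unfolding E_def s_def by (simp add: eval_nat_numeral diff_diff_eq)
  have R: "increment_order {lo..hi} 4 R"
    using flow_order[of 3] assms unfolding R_def by (simp add: eval_nat_numeral add_ac)
  have c: "increment_order {lo..hi} 4 c"
    unfolding c_def
    using increment_order_mult_increment[OF exp_phi_orders(4)]
    by (intro increment_order_diff increment_order_cmult exp_phi_orders(5)) simp
  have "increment_order {lo..hi} 4
      (\<lambda>a b. - (q a b *\<^sub>R (E a b + G a b)) - c a b *\<^sub>R d 2 a - R a b)"
    using increment_order_scaleR[OF exp_phi_orders(3)[where c = "3/2"] increment_order_add[OF E G]]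
      increment_order_scaleR[OF c increment_order_bounded[OF bounded_d[of 2]]] assms
    unfolding q_def by (intro increment_order_diff increment_order_uminus R) simp_all
  then show ?thesis
  proof (rule increment_order_cong)
    fix a b assume ab: "a \<in> {lo..hi}" "b \<in> {lo..hi}" "a < b"
    have q1: "q a b * (2/3 * (b - a)) = exp_phi 2 a b"
      using ab by (simp add: q_def)
    \<comment> \<open>One node factor is split off so that \<open>q1\<close> applies; half of the
      remaining one is \<open>1/3 * (b - a)\<close>.\<close>
    have "q a b * ((2/3 * (b - a)) ^ 2 / 2) = (q a b * (2/3 * (b - a))) * (1/3 * (b - a))"
      by (simp add: power2_eq_square)
    also have "\<dots> = exp_phi 2 a b * (1/3 * (b - a))" unfolding q1 ..
    also have "\<dots> = c a b + exp_phi 3 a b"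
    proof -
      have phi_eq: "exp_phi 2 a b = exp_phi 3 a b + exp (- b) * ((b - a) ^ 2 / 2)"
        "exp_phi 3 a b = exp_phi 4 a b + exp (- b) * ((b - a) ^ 3 / 6)"
        using exp_phi_rec[of 2 a b] exp_phi_rec[of 3 a b] by (simp_all add: eval_nat_numeral)
      have "p2 * (1/3 * h) = 1/3 * (p3 * h) - p4 + p3"
        if "p2 = p3 + e * (h ^ 2 / 2)" "p3 = p4 + e * (h ^ 3 / 6)" for p2 p3 p4 e h :: real
        unfolding that by (simp add: field_simps power2_eq_square power3_eq_cube)
      from this[OF phi_eq] show ?thesis unfolding c_def .
    qed
    finally have q2: "q a b * ((2/3 * (b - a)) ^ 2 / 2) = c a b + exp_phi 3 a b" .
    have "step3 a b (Y a) - Y b = Y a - exp_phi 1 a b *\<^sub>R d 0 a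
      - q a b *\<^sub>R (G a b + E a b + (2/3 * (b - a)) *\<^sub>R d 1 a + ((2/3 * (b - a)) ^ 2 / 2) *\<^sub>R d 2 a) - Y b"
      using ab by (simp add: step3_def Let_def s_def G_def E_def q_def d_0)
    then show "step3 a b (Y a) - Y b = - (q a b *\<^sub>R (E a b + G a b)) - c a b *\<^sub>R d 2 a - R a b"
      unfolding R_def scaleR_right_distrib scaleR_scaleR q1 q2 by (simp add: algebra_simps)
  qed
qed

end


subsection \<open>The diffusion ODE in the variable \<open>\<lambda>\<close>\<close>

locale dpm_problem =
  fixes T :: real and \<alpha> \<sigma> :: "real \<Rightarrow> real"
    and \<epsilon> :: "real ^ 'n \<Rightarrow> real \<Rightarrow> real ^ 'n"
    and xT :: "real ^ 'n" and x :: "real \<Rightarrow> real ^ 'n" and L :: real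
  assumes T_pos: "0 < T"
    and schedule: "noise_schedule T \<alpha> \<sigma>"
    and solution: "diffusion_ode_solution T \<alpha> \<sigma> \<epsilon> xT x"
    and L_nonneg: "0 \<le> L"
    and eps_lipschitz: "s \<in> {0..T} \<Longrightarrow> norm (\<epsilon> y s - \<epsilon> z s) \<le> L * norm (y - z)"
begin

abbreviation "\<Lambda> \<equiv> lam \<alpha> \<sigma>"
abbreviation "\<tau> \<equiv> t_lam T \<alpha> \<sigma>"
text \<open>The solver runs from time \<open>T\<close> down to \<open>0\<close>; as
  \<open>\<Lambda>\<close> decreases, this is an upward run from \<open>lo\<close> to
  \<open>hi\<close>.\<close>

abbreviation "lo \<equiv> \<Lambda> T"
abbreviation "hi \<equiv> \<Lambda> 0"

definition F :: "real \<Rightarrow> real ^ 'n \<Rightarrow> real ^ 'n" where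
  "F u z = \<epsilon> (\<alpha> (\<tau> u) *\<^sub>R z) (\<tau> u)"

definition Y :: "real \<Rightarrow> real ^ 'n" where
  "Y u = (1 / \<alpha> (\<tau> u)) *\<^sub>R x (\<tau> u)"

lemma \<alpha>_pos: "t \<in> {0..T} \<Longrightarrow> 0 < \<alpha> t" and \<sigma>_pos: "t \<in> {0..T} \<Longrightarrow> 0 < \<sigma> t"
  using schedule unfolding noise_schedule_def by auto

lemma lam_decreasing:
  assumes "0 \<le> s" "s < t" "t \<le> T"
  shows "\<Lambda> t < \<Lambda> s"
proof -
  have snr_decreasing: "monotone_on {0..T} (<) (>) (\<lambda>t. (\<alpha> t)\<^sup>2 / (\<sigma> t)\<^sup>2)"
    using schedule unfolding noise_schedule_def by (elim conjE)
  have mem: "s \<in> {0..T}" "t \<in> {0..T}" using assms by auto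
  have "(\<alpha> t)\<^sup>2 / (\<sigma> t)\<^sup>2 < (\<alpha> s)\<^sup>2 / (\<sigma> s)\<^sup>2"
    by (rule monotone_onD[OF snr_decreasing mem assms(2)])
  then have "(\<alpha> t / \<sigma> t)\<^sup>2 < (\<alpha> s / \<sigma> s)\<^sup>2" by (simp add: power_divide)
  then have "\<alpha> t / \<sigma> t < \<alpha> s / \<sigma> s"
    by (rule power_less_imp_less_base) (use \<alpha>_pos[OF mem(1)] \<sigma>_pos[OF mem(1)] in simp)
  then show ?thesis
    unfolding lam_def using \<alpha>_pos \<sigma>_pos mem by (intro ln_less_cancel_iff[THEN iffD2]) auto
qed

lemma \<alpha>_deriv: "t \<in> {0..T} \<Longrightarrow>
    (\<alpha> has_real_derivative vector_derivative \<alpha> (at t within {0..T})) (at t within {0..T})"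
  and \<sigma>_deriv: "t \<in> {0..T} \<Longrightarrow>
    (\<sigma> has_real_derivative vector_derivative \<sigma> (at t within {0..T})) (at t within {0..T})"
  using schedule unfolding noise_schedule_def differentiable_on_def
    has_real_derivative_iff_has_vector_derivative
  by (auto simp: vector_derivative_works)

lemma \<alpha>_cont: "continuous_on {0..T} \<alpha>" and \<sigma>_cont: "continuous_on {0..T} \<sigma>"
  using schedule unfolding noise_schedule_def
  by (auto intro: differentiable_imp_continuous_on)

lemma lam_cont: "continuous_on {0..T} \<Lambda>"
  unfolding lam_def using \<alpha>_pos \<sigma>_pos
  by (intro continuous_intros \<alpha>_cont \<sigma>_cont) (auto simp: less_imp_neq[symmetric] less_imp_neq)

lemma lam_image: "\<Lambda> ` {0..T} = {lo..hi}"
proof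
  show "\<Lambda> ` {0..T} \<subseteq> {lo..hi}"
  proof
    fix v assume "v \<in> \<Lambda> ` {0..T}"
    then obtain t where "t \<in> {0..T}" "v = \<Lambda> t" by blast
    then show "v \<in> {lo..hi}"
      using lam_decreasing[of 0 t] lam_decreasing[of t T] by (cases "t = 0"; cases "t = T") auto
  qed
  show "{lo..hi} \<subseteq> \<Lambda> ` {0..T}"
  proof
    fix v assume "v \<in> {lo..hi}"
    then have "\<exists>t\<ge>0. t \<le> T \<and> \<Lambda> t = v"
      using T_pos lam_cont by (intro IVT2') auto
    then show "v \<in> \<Lambda> ` {0..T}" by auto
  qed
qed

lemma lam_inj: "inj_on \<Lambda> {0..T}"
  by (rule linorder_inj_onI) (use lam_decreasing in fastforce)+

lemma t_lam_lam [simp]: "t \<in> {0..T} \<Longrightarrow> \<tau> (\<Lambda> t) = t"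
  unfolding t_lam_def using lam_inj by (rule the_inv_into_f_f)

lemma lam_t_lam [simp]: "u \<in> {lo..hi} \<Longrightarrow> \<Lambda> (\<tau> u) = u"
  and t_lam_mem: "u \<in> {lo..hi} \<Longrightarrow> \<tau> u \<in> {0..T}"
  using f_the_inv_into_f[OF lam_inj, of u] the_inv_into_into[OF lam_inj, of u "{0..T}"]
  unfolding t_lam_def lam_image by auto

text \<open>Eliminates \<open>\<sigma>\<close> from the solvers:
  \<open>\<sigma> t * (exp h - 1)\<close> becomes \<open>\<alpha> t\<close> times a weight
  \<open>exp_phi 1\<close>.\<close>

lemma \<sigma>_eq: "t \<in> {0..T} \<Longrightarrow> \<sigma> t = \<alpha> t * exp (- \<Lambda> t)"
  using \<alpha>_pos[of t] \<sigma>_pos[of t] unfolding lam_def by (simp add: exp_minus)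

lemma ex_lipschitz_constant: "\<exists>K. semilinear_flow lo hi F K"
proof -
  have "bounded (\<alpha> ` {0..T})"
    by (intro compact_imp_bounded compact_continuous_image \<alpha>_cont) auto
  then obtain A where A: "0 < A" "\<And>t. t \<in> {0..T} \<Longrightarrow> \<bar>\<alpha> t\<bar> \<le> A"
    unfolding bounded_pos by auto
  show ?thesis
  proof (intro exI[of _ "L * A"] semilinear_flow.intro)
    fix u z z' assume u: "u \<in> {lo..hi}"
    have "norm (F u z - F u z') \<le> L * norm (\<alpha> (\<tau> u) *\<^sub>R z - \<alpha> (\<tau> u) *\<^sub>R z')"
      unfolding F_def by (rule eps_lipschitz[OF t_lam_mem[OF u]])
    also have "\<dots> = L * (\<bar>\<alpha> (\<tau> u)\<bar> * norm (z - z'))"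
      by (simp add: scaleR_right_diff_distrib[symmetric])
    also have "\<dots> \<le> L * (A * norm (z - z'))"
      using L_nonneg A(2)[OF t_lam_mem[OF u]] by (intro mult_left_mono mult_right_mono) auto
    finally show "norm (F u z - F u z') \<le> L * A * norm (z - z')" by (simp add: mult.assoc)
  qed (use A L_nonneg in simp)
qed

lemma F_Y: "u \<in> {lo..hi} \<Longrightarrow> F u (Y u) = \<epsilon> (x (\<tau> u)) (\<tau> u)"
  using \<alpha>_pos[OF t_lam_mem[of u]] unfolding F_def Y_def by simp

lemma lam_deriv:
  assumes "t \<in> {0..T}"
  shows "(\<Lambda> has_real_derivative
    vector_derivative \<alpha> (at t within {0..T}) / \<alpha> t - vector_derivative \<sigma> (at t within {0..T}) / \<sigma> t)
    (at t within {0..T})"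
  unfolding lam_def using \<alpha>_pos[OF assms] \<sigma>_pos[OF assms]
  by (auto intro!: derivative_eq_intros \<alpha>_deriv[OF assms] \<sigma>_deriv[OF assms] simp: field_simps)

text \<open>The integrating factor \<open>1 / \<alpha>\<close> removes the drift, and what remains
  of the diffusion coefficient is \<open>- l * exp (- \<Lambda> t)\<close>, where \<open>l\<close>
  is the derivative of \<open>\<Lambda>\<close>.\<close>

lemma scaled_solution_deriv:
  assumes t: "t \<in> {0..T}" and l: "(\<Lambda> has_real_derivative l) (at t within {0..T})"
  shows "((\<lambda>t. (1 / \<alpha> t) *\<^sub>R x t) has_vector_derivative
    l *\<^sub>R (- (exp (- \<Lambda> t) *\<^sub>R \<epsilon> (x t) t))) (at t within {0..T})"
proof -
  let ?a = "vector_derivative \<alpha> (at t within {0..T})"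
  let ?s = "vector_derivative \<sigma> (at t within {0..T})"
  note pos = \<alpha>_pos[OF t] \<sigma>_pos[OF t]
  \<comment> \<open>Derivatives within \<open>{0..T}\<close> are unique since \<open>0 < T\<close>,
    also at the end points.\<close>
  have vd: "vector_derivative f (at t within {0..T}) = f'"
    if "(f has_real_derivative f') (at t within {0..T})" for f :: "real \<Rightarrow> real" and f'
    using that t T_pos unfolding has_real_derivative_iff_has_vector_derivative
    by (intro vector_derivative_within_closed_interval)
  have "((\<lambda>s. ln (\<alpha> s)) has_real_derivative ?a / \<alpha> t) (at t within {0..T})"
    using pos by (auto intro!: derivative_eq_intros \<alpha>_deriv[OF t])
  then have drift: "drift T \<alpha> t = ?a / \<alpha> t" unfolding drift_def by (rule vd)
  have "((\<lambda>s. (\<sigma> s)\<^sup>2) has_real_derivative 2 * \<sigma> t * ?s) (at t within {0..T})"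
    by (auto intro!: derivative_eq_intros \<sigma>_deriv[OF t])
  then have diffusion: "diffusion_sq T \<alpha> \<sigma> t = 2 * \<sigma> t * ?s - 2 * (?a / \<alpha> t) * (\<sigma> t)\<^sup>2"
    unfolding diffusion_sq_def drift by (subst vd) auto
  have l_eq: "l = ?a / \<alpha> t - ?s / \<sigma> t"
    using vd[OF l] vd[OF lam_deriv[OF t]] by simp
  have c_eq: "diffusion_sq T \<alpha> \<sigma> t / (2 * \<sigma> t) / \<alpha> t = - (l * exp (- \<Lambda> t))"
    using pos \<sigma>_eq[OF t] unfolding diffusion l_eq
    by (simp add: field_simps power2_eq_square)
  have inv: "((\<lambda>t. 1 / \<alpha> t) has_real_derivative - (?a / \<alpha> t / \<alpha> t)) (at t within {0..T})"
    using pos by (auto intro!: derivative_eq_intros \<alpha>_deriv[OF t])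
  have "(x has_vector_derivative (drift T \<alpha> t *\<^sub>R x t + (diffusion_sq T \<alpha> \<sigma> t / (2 * \<sigma> t)) *\<^sub>R \<epsilon> (x t) t))
      (at t within {0..T})"
    using solution t unfolding diffusion_ode_solution_def by blast
  from has_vector_derivative_scaleR[OF inv this]
  have "((\<lambda>t. (1 / \<alpha> t) *\<^sub>R x t) has_vector_derivative
      (diffusion_sq T \<alpha> \<sigma> t / (2 * \<sigma> t) / \<alpha> t) *\<^sub>R \<epsilon> (x t) t) (at t within {0..T})"
    unfolding drift by (simp add: scaleR_right_distrib mult_ac)
  then show ?thesis unfolding c_eq by simp
qed

text \<open>The chain rule is applied through \<open>\<Lambda>\<close>, which is differentiable, and
  never through its inverse.\<close>

lemma Y_has_vector_derivative:
  assumes cont: "continuous_on {lo..hi} (\<lambda>u. F u (Y u))" and u: "u \<in> {lo..hi}"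
  shows "(Y has_vector_derivative - (exp (- u) *\<^sub>R F u (Y u))) (at u within {lo..hi})"
proof -
  define g where "g = (\<lambda>u. - (exp (- u) *\<^sub>R F u (Y u)))"
  define G where "G = (\<lambda>u. integral {lo..u} g)"
  have "continuous_on {lo..hi} g"
    unfolding g_def by (intro continuous_intros cont)
  then have G: "(G has_vector_derivative g u) (at u within {lo..hi})" if "u \<in> {lo..hi}" for u
    unfolding G_def using that by (rule integral_has_vector_derivative)
  \<comment> \<open>Both terms have derivative \<open>l *\<^sub>R g (\<Lambda> t)\<close>, even
    where \<open>l = 0\<close>; the difference is therefore constant, and substituting
    \<open>t = \<tau> v\<close> gives \<open>Y\<close> up to that constant.\<close>
  have "((\<lambda>t. (1 / \<alpha> t) *\<^sub>R x t - (G \<circ> \<Lambda>) t) has_vector_derivative 0) (at t within {0..T})"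
    if t: "t \<in> {0..T}" for t
  proof -
    obtain l where l: "(\<Lambda> has_real_derivative l) (at t within {0..T})"
      using lam_deriv[OF t] by blast
    have mem: "\<Lambda> t \<in> {lo..hi}" using lam_image t by blast
    have "((G \<circ> \<Lambda>) has_vector_derivative l *\<^sub>R g (\<Lambda> t)) (at t within {0..T})"
      using l G[OF mem] unfolding has_real_derivative_iff_has_vector_derivative
      by (intro vector_diff_chain_within) (simp_all add: lam_image)
    from has_vector_derivative_diff[OF scaled_solution_deriv[OF t l] this]
    show ?thesis using F_Y[OF mem] t by (simp add: g_def)
  qed
  then obtain c where c: "\<And>t. t \<in> {0..T} \<Longrightarrow> (1 / \<alpha> t) *\<^sub>R x t - (G \<circ> \<Lambda>) t = c"
    by (rule has_vector_derivative_zero_constant[of "{0..T}", rotated]) auto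
  have "Y v = G v + c" if "v \<in> {lo..hi}" for v
    using c[OF t_lam_mem[OF that]] that by (simp add: Y_def algebra_simps)
  moreover have "((\<lambda>v. G v + c) has_vector_derivative g u) (at u within {lo..hi})"
    using has_vector_derivative_add[OF G[OF u] has_vector_derivative_const] by simp
  ultimately show ?thesis
    using u unfolding g_def by (rule_tac has_vector_derivative_transform) auto
qed

lemma F_lam: "s \<in> {0..T} \<Longrightarrow> F (\<Lambda> s) z = \<epsilon> (\<alpha> s *\<^sub>R z) s"
  by (simp add: F_def)

section \<open>The solvers as rescaled exponential Runge-Kutta steps\<close>

context
  fixes K assumes flow: "semilinear_flow lo hi F K"
begin

interpretation semilinear_flow lo hi F K by (rule flow)

lemma dpm_step1_scaled:
  assumes s: "s \<in> {0..T}" and t: "t \<in> {0..T}"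
  shows "dpm_step1 \<alpha> \<sigma> \<epsilon> s t (\<alpha> s *\<^sub>R z) = \<alpha> t *\<^sub>R step1 (\<Lambda> s) (\<Lambda> t) z"
  using \<alpha>_pos[OF s] \<sigma>_eq[OF t]
  by (simp add: dpm_step1_def step1_def Let_def F_lam[OF s] exp_phi_def scaleR_right_diff_distrib)

lemma dpm_step2_scaled:
  assumes s: "s \<in> {0..T}" and t: "t \<in> {0..T}" and less: "t < s"
  shows "dpm_step2 T \<alpha> \<sigma> \<epsilon> s t (\<alpha> s *\<^sub>R z) = \<alpha> t *\<^sub>R step2 (\<Lambda> s) (\<Lambda> t) z"
proof -
  define a b where "a = \<Lambda> s" and "b = \<Lambda> t"
  have ab: "a \<in> {lo..hi}" "b \<in> {lo..hi}" "a < b"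
    using lam_image s t less lam_decreasing[of t s] unfolding a_def b_def by auto
  define m where "m = a + 1/2 * (b - a)"
  have m: "m \<in> {lo..hi}" unfolding m_def by (rule intermediate_point[OF ab]) auto
  note \<tau> = t_lam_mem[OF m]
  have node: "(a + b) / 2 = m" "(b - a) / 2 = m - a" by (simp_all add: m_def field_simps)
  \<comment> \<open>The intermediate value is itself a DPM-Solver-1 step, from \<open>s\<close> to
    \<open>\<tau> m\<close>.\<close>
  have u: "(\<alpha> (\<tau> m) / \<alpha> s) *\<^sub>R (\<alpha> s *\<^sub>R z) - (\<sigma> (\<tau> m) * (exp (m - a) - 1)) *\<^sub>R \<epsilon> (\<alpha> s *\<^sub>R z) s
      = \<alpha> (\<tau> m) *\<^sub>R step1 a m z"
    using dpm_step1_scaled[OF s \<tau>, of z] m unfolding dpm_step1_def Let_def a_def by simp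
  have "dpm_step2 T \<alpha> \<sigma> \<epsilon> s t (\<alpha> s *\<^sub>R z) = \<alpha> t *\<^sub>R z - (\<sigma> t * (exp (b - a) - 1)) *\<^sub>R F m (step1 a m z)"
    using \<alpha>_pos[OF s]
    unfolding dpm_step2_def Let_def a_def[symmetric] b_def[symmetric] node u F_def by simp
  also have "\<dots> = \<alpha> t *\<^sub>R step2 a b z"
    using \<sigma>_eq[OF t] unfolding b_def[symmetric]
    unfolding step2_def Let_def m_def[symmetric]
    by (simp add: exp_phi_def scaleR_right_diff_distrib mult.assoc)
  finally show ?thesis unfolding a_def b_def .
qed

lemma dpm_step3_scaled:
  assumes s: "s \<in> {0..T}" and t: "t \<in> {0..T}" and less: "t < s"
  shows "dpm_step3 T \<alpha> \<sigma> \<epsilon> s t (\<alpha> s *\<^sub>R z) = \<alpha> t *\<^sub>R step3 (\<Lambda> s) (\<Lambda> t) z"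
proof -
  define a b where "a = \<Lambda> s" and "b = \<Lambda> t"
  have ab: "a \<in> {lo..hi}" "b \<in> {lo..hi}" "a < b"
    using lam_image s t less lam_decreasing[of t s] unfolding a_def b_def by auto
  define p where "p = a + 2/3 * (b - a)"
  have p: "p \<in> {lo..hi}" unfolding p_def by (rule intermediate_point[OF ab]) auto
  have ap: "a < p" using ab by (simp add: p_def)
  \<comment> \<open>The node \<open>1/3\<close> of the whole step, written as the midpoint of
    \<open>{a..p}\<close> to match \<open>stage3 a p\<close>.\<close>
  define m where "m = a + 1/2 * (p - a)"
  have m: "m \<in> {lo..hi}" unfolding m_def by (rule intermediate_point[OF ab(1) p ap]) auto
  note \<tau>m = t_lam_mem[OF m] and \<tau>p = t_lam_mem[OF p]
  have node: "1/3 * (b - a) = m - a" "2/3 * (b - a) = p - a" "a + (v - a) = v" for v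
    by (simp_all add: m_def p_def)
  have E0: "\<epsilon> (\<alpha> s *\<^sub>R z) s = F a z" using F_lam[OF s] by (simp add: a_def)
  have u1: "(\<alpha> (\<tau> m) / \<alpha> s) *\<^sub>R (\<alpha> s *\<^sub>R z) - (\<sigma> (\<tau> m) * (exp (m - a) - 1)) *\<^sub>R F a z
      = \<alpha> (\<tau> m) *\<^sub>R step1 a m z"
    using dpm_step1_scaled[OF s \<tau>m, of z] m E0 unfolding dpm_step1_def Let_def a_def by simp
  \<comment> \<open>The solver's bracket is a rescaled \<open>exp_phi 2\<close>; cancelling
    \<open>v - a\<close> needs \<open>a < v\<close>.\<close>
  have quotient: "(exp (v - a) - 1) / (v - a) - 1 = exp v * exp_phi 2 a v / (v - a)" if "a < v" for v
    using that by (simp add: exp_phi_def numeral_2_eq_2 exp_minus field_simps)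
  have \<sigma>_exp: "\<sigma> (\<tau> p) * exp p = \<alpha> (\<tau> p)" "\<sigma> t * exp b = \<alpha> t"
    using \<sigma>_eq[OF \<tau>p] \<sigma>_eq[OF t] p by (simp_all add: b_def exp_minus)
  have c1: "\<sigma> (\<tau> p) * (2/3) / (1/3) * ((exp (p - a) - 1) / (p - a) - 1)
      = \<alpha> (\<tau> p) * (2 * (exp_phi 2 a p / (p - a)))"
    unfolding quotient[OF ap] \<sigma>_exp(1)[symmetric] by simp
  have c2: "\<sigma> t / (2/3) * ((exp (b - a) - 1) / (b - a) - 1)
      = \<alpha> t * (3/2 * (exp_phi 2 a b / (b - a)))"
    unfolding quotient[OF ab(3)] \<sigma>_exp(2)[symmetric] by simp
  have c0: "\<sigma> (\<tau> p) * (exp (p - a) - 1) = \<alpha> (\<tau> p) * exp_phi 1 a p"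
      "\<sigma> t * (exp (b - a) - 1) = \<alpha> t * exp_phi 1 a b"
    using \<sigma>_eq[OF \<tau>p] \<sigma>_eq[OF t] p by (simp_all add: b_def exp_phi_def)
  have E1: "\<epsilon> (\<alpha> (\<tau> m) *\<^sub>R step1 a m z) (\<tau> m) = F m (step1 a m z)" by (simp add: F_def)
  have u2: "(\<alpha> (\<tau> p) / \<alpha> s) *\<^sub>R (\<alpha> s *\<^sub>R z) - (\<alpha> (\<tau> p) * exp_phi 1 a p) *\<^sub>R F a z
      - (\<alpha> (\<tau> p) * (2 * (exp_phi 2 a p / (p - a)))) *\<^sub>R (F m (step1 a m z) - F a z)
      = \<alpha> (\<tau> p) *\<^sub>R stage3 a p z"
    using \<alpha>_pos[OF s] unfolding stage3_def Let_def m_def[symmetric]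
    by (simp add: scaleR_right_diff_distrib)
  have E2: "\<epsilon> (\<alpha> (\<tau> p) *\<^sub>R stage3 a p z) (\<tau> p) = F p (stage3 a p z)" by (simp add: F_def)
  have "dpm_step3 T \<alpha> \<sigma> \<epsilon> s t (\<alpha> s *\<^sub>R z) = (\<alpha> t / \<alpha> s) *\<^sub>R (\<alpha> s *\<^sub>R z)
      - (\<alpha> t * exp_phi 1 a b) *\<^sub>R F a z
      - (\<alpha> t * (3/2 * (exp_phi 2 a b / (b - a)))) *\<^sub>R (F p (stage3 a p z) - F a z)"
    unfolding dpm_step3_def Let_def a_def[symmetric] b_def[symmetric] node E0 u1 E1 c0 c1 c2 u2 E2 ..
  also have "\<dots> = \<alpha> t *\<^sub>R step3 a b z"
    using \<alpha>_pos[OF s] unfolding step3_def Let_def p_def[symmetric]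
    by (simp add: scaleR_right_diff_distrib)
  finally show ?thesis unfolding a_def b_def .
qed

end

text \<open>Hides which solver is meant: convergence needs only stability, consistency and the
  conjugation of the step by \<open>\<alpha>\<close>.\<close>

lemma dpm_scaled_method:
  assumes "k \<in> {1, 2, 3}"
    and smooth: "has_continuous_derivatives_upto (k + 1) (\<lambda>u. \<epsilon> (x (\<tau> u)) (\<tau> u)) {lo..hi}"
  obtains \<Phi> where "increment_lipschitz {lo..hi} 1 (\<lambda>a b z. \<Phi> a b z - z)"
    "increment_order {lo..hi} (Suc k) (\<lambda>a b. \<Phi> a b (Y a) - Y b)"
    "\<And>s t z. s \<in> {0..T} \<Longrightarrow> t \<in> {0..T} \<Longrightarrow> t < s \<Longrightarrow>
       dpm_step k T \<alpha> \<sigma> \<epsilon> s t (\<alpha> s *\<^sub>R z) = \<alpha> t *\<^sub>R \<Phi> (\<Lambda> s) (\<Lambda> t) z"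
proof -
  obtain K where K: "semilinear_flow lo hi F K" using ex_lipschitz_constant by blast
  obtain d where d: "\<And>u. u \<in> {lo..hi} \<Longrightarrow> d 0 u = F u (Y u)"
      "\<And>j u. j < k + 1 \<Longrightarrow> u \<in> {lo..hi} \<Longrightarrow> (d j has_vector_derivative d (Suc j) u) (at u within {lo..hi})"
      "\<And>j. j \<le> k + 1 \<Longrightarrow> continuous_on {lo..hi} (d j)"
  proof -
    obtain d where "\<forall>u\<in>{lo..hi}. d 0 u = \<epsilon> (x (\<tau> u)) (\<tau> u)"
      "\<forall>j<k + 1. \<forall>u\<in>{lo..hi}. (d j has_vector_derivative d (Suc j) u) (at u within {lo..hi})"
      "\<forall>j\<le>k + 1. continuous_on {lo..hi} (d j)"
      using smooth unfolding has_continuous_derivatives_upto_def by blast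
    then show thesis using F_Y by (intro that[of d]) auto
  qed
  have "continuous_on {lo..hi} (\<lambda>u. F u (Y u))"
    using d(3)[of 0] by (subst continuous_on_cong[OF refl d(1)[symmetric]]) auto
  then have "(Y has_vector_derivative - (exp (- u) *\<^sub>R d 0 u)) (at u within {lo..hi})"
    if "u \<in> {lo..hi}" for u
    using Y_has_vector_derivative that d(1) by simp
  then interpret smooth_semilinear_flow lo hi F K Y d "k + 1"
    using K d by (intro smooth_semilinear_flow.intro smooth_semilinear_flow_axioms.intro)
  consider "k = 1" | "k = 2" | "k = 3" using assms(1) by blast
  then show thesis
  proof cases
    case 1
    then show thesis using dpm_step1_scaled[OF K] step1_stable step1_consistent
      by (intro that[of step1]) (auto simp: dpm_step_def numeral_2_eq_2)
  next
    case 2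
    then show thesis using dpm_step2_scaled[OF K] step2_stable step2_consistent
      by (intro that[of step2]) (auto simp: dpm_step_def)
  next
    case 3
    then show thesis using dpm_step3_scaled[OF K] step3_stable step3_consistent
      by (intro that[of step3]) (auto simp: dpm_step_def)
  qed
qed

section \<open>Global convergence of the solvers\<close>

lemma time_steps_mem:
  assumes "time_steps T M ts" "i \<le> M"
  shows "ts i \<in> {0..T}"
proof -
  have ts: "ts 0 = T" "ts M = 0" "\<And>i. i < M \<Longrightarrow> ts (Suc i) < ts i"
    using assms(1) unfolding time_steps_def by auto
  have "ts i \<le> T" using assms(2)
    by (induction i) (use ts in \<open>force dest: Suc_le_lessD\<close>)+
  \<comment> \<open>The lower bound is propagated downwards from the last index \<open>M\<close>,
    where \<open>ts M = 0\<close>.\<close>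
  moreover have "0 \<le> ts i" using assms(2)
  proof (induction rule: inc_induct)
    case (step j)
    then show ?case using ts(3)[of j] by simp
  qed (use ts in simp)
  ultimately show ?thesis by simp
qed

lemma dpm_solver_convergence:
  assumes "k \<in> {1, 2, 3}"
    and "has_continuous_derivatives_upto (k + 1) (\<lambda>u. \<epsilon> (x (\<tau> u)) (\<tau> u)) {lo..hi}"
  shows "\<exists>C>0. \<forall>M\<ge>1. \<forall>ts. time_steps T M ts \<longrightarrow>
    norm (dpm_solver k T \<alpha> \<sigma> \<epsilon> xT ts M - x 0) \<le> C * h_max \<alpha> \<sigma> M ts ^ k"
proof -
  obtain \<Phi> where \<Phi>: "increment_lipschitz {lo..hi} 1 (\<lambda>a b z. \<Phi> a b z - z)"
    "increment_order {lo..hi} (Suc k) (\<lambda>a b. \<Phi> a b (Y a) - Y b)"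
    "\<And>s t z. s \<in> {0..T} \<Longrightarrow> t \<in> {0..T} \<Longrightarrow> t < s \<Longrightarrow>
       dpm_step k T \<alpha> \<sigma> \<epsilon> s t (\<alpha> s *\<^sub>R z) = \<alpha> t *\<^sub>R \<Phi> (\<Lambda> s) (\<Lambda> t) z"
    using dpm_scaled_method[OF assms] by blast
  obtain C where C: "0 \<le> C"
    "\<And>M us zs H. us 0 = lo \<Longrightarrow> us M = hi \<Longrightarrow> zs 0 = Y lo \<Longrightarrow>
       (\<And>i. i \<le> M \<Longrightarrow> us i \<in> {lo..hi}) \<Longrightarrow>
       (\<And>i. i < M \<Longrightarrow> us i < us (Suc i)) \<Longrightarrow> (\<And>i. i < M \<Longrightarrow> us (Suc i) - us i \<le> H) \<Longrightarrow>
       (\<And>i. i < M \<Longrightarrow> zs (Suc i) = \<Phi> (us i) (us (Suc i)) (zs i)) \<Longrightarrow>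
       norm (zs M - Y hi) \<le> C * H ^ k"
    using one_step_method_convergence[OF \<Phi>(1,2)] by blast
  have mem: "0 \<in> {0..T}" "T \<in> {0..T}" using T_pos by auto
  show ?thesis
  \<comment> \<open>The factor \<open>\<alpha> 0\<close> undoes the rescaling at the final time;
    adding 1 makes the constant positive, as \<open>C\<close> may be 0.\<close>
  proof (intro exI[of _ "\<alpha> 0 * C + 1"] conjI allI impI)
    show "0 < \<alpha> 0 * C + 1" using \<alpha>_pos[OF mem(1)] C(1) by (simp add: add_nonneg_pos)
  next
    fix M :: nat and ts assume M: "1 \<le> M" and steps: "time_steps T M ts"
    let ?X = "dpm_solver k T \<alpha> \<sigma> \<epsilon> xT ts"
    let ?H = "h_max \<alpha> \<sigma> M ts"
    define zs where "zs = (\<lambda>i. (1 / \<alpha> (ts i)) *\<^sub>R ?X i)"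
    have ts: "ts 0 = T" "ts M = 0" "\<And>i. i < M \<Longrightarrow> ts (Suc i) < ts i"
      using steps unfolding time_steps_def by auto
    note ts_mem = time_steps_mem[OF steps]
    have incr: "\<Lambda> (ts i) < \<Lambda> (ts (Suc i))" if "i < M" for i
      using lam_decreasing[of "ts (Suc i)" "ts i"] ts(3)[OF that] ts_mem[of i] ts_mem[of "Suc i"] that
      by simp
    \<comment> \<open>In \<open>h_max\<close> a step is indexed by its end point, so this one is the
      entry \<open>Suc i\<close>.\<close>
    have H: "\<Lambda> (ts (Suc i)) - \<Lambda> (ts i) \<le> ?H" if "i < M" for i
      unfolding h_max_def using that by (intro Max_ge) (auto intro!: image_eqI[of _ _ "Suc i"])
    have H_nonneg: "0 \<le> ?H" using H[of 0] incr[of 0] M by simp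
    have "norm (zs M - Y hi) \<le> C * ?H ^ k"
    proof (rule C(2)[where us = "\<lambda>i. \<Lambda> (ts i)"])
      have "x T = xT" using solution unfolding diffusion_ode_solution_def by blast
      then show "zs 0 = Y lo" using mem ts by (simp add: zs_def Y_def)
      show "\<Lambda> (ts i) \<in> {lo..hi}" if "i \<le> M" for i using lam_image ts_mem[OF that] by blast
      show "zs (Suc i) = \<Phi> (\<Lambda> (ts i)) (\<Lambda> (ts (Suc i))) (zs i)" if i: "i < M" for i
      proof -
        have pos: "0 < \<alpha> (ts i)" "0 < \<alpha> (ts (Suc i))" using \<alpha>_pos ts_mem i by auto
        have "?X i = \<alpha> (ts i) *\<^sub>R zs i" using pos by (simp add: zs_def)
        then have "?X (Suc i) = \<alpha> (ts (Suc i)) *\<^sub>R \<Phi> (\<Lambda> (ts i)) (\<Lambda> (ts (Suc i))) (zs i)"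
          using \<Phi>(3)[of "ts i" "ts (Suc i)" "zs i"] ts_mem[of i] ts_mem[of "Suc i"] ts(3) i by simp
        then show ?thesis using pos by (simp add: zs_def)
      qed
    qed (use ts incr H in auto)
    moreover have "?X M - x 0 = \<alpha> 0 *\<^sub>R (zs M - Y hi)"
      using \<alpha>_pos[OF mem(1)] mem ts by (simp add: zs_def Y_def scaleR_right_diff_distrib)
    ultimately have "norm (?X M - x 0) \<le> \<alpha> 0 * (C * ?H ^ k)"
      using \<alpha>_pos[OF mem(1)] by simp
    also have "\<dots> \<le> (\<alpha> 0 * C + 1) * ?H ^ k"
      using H_nonneg by (simp add: algebra_simps)
    finally show "norm (?X M - x 0) \<le> (\<alpha> 0 * C + 1) * ?H ^ k" .
  qed
qed

end

theorem theorem3p2: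
  fixes T :: real and \<alpha> \<sigma> :: "real \<Rightarrow> real"
    and \<epsilon> :: "real ^ 'n \<Rightarrow> real \<Rightarrow> real ^ 'n"
    and xT :: "real ^ 'n" and x :: "real \<Rightarrow> real ^ 'n" and k :: nat
  assumes "k \<in> {1, 2, 3}"
    and "T > 0"
    and "noise_schedule T \<alpha> \<sigma>"
    and "diffusion_ode_solution T \<alpha> \<sigma> \<epsilon> xT x"
    and "has_continuous_derivatives_upto (k + 1)
           (\<lambda>u. \<epsilon> (x (t_lam T \<alpha> \<sigma> u)) (t_lam T \<alpha> \<sigma> u)) {lam \<alpha> \<sigma> T..lam \<alpha> \<sigma> 0}"
    and "\<exists>L\<ge>0. \<forall>s\<in>{0..T}. \<forall>y z. norm (\<epsilon> y s - \<epsilon> z s) \<le> L * norm (y - z)"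
  shows "\<forall>c>0. \<exists>C>0. \<forall>M\<ge>1. \<forall>ts.
           time_steps T M ts \<and> h_max \<alpha> \<sigma> M ts \<le> c / real M \<longrightarrow>
           norm (dpm_solver k T \<alpha> \<sigma> \<epsilon> xT ts M - x 0) \<le> C * h_max \<alpha> \<sigma> M ts ^ k"
proof -
  obtain L where "0 \<le> L" "\<forall>s\<in>{0..T}. \<forall>y z. norm (\<epsilon> y s - \<epsilon> z s) \<le> L * norm (y - z)"
    using assms(6) by blast
  then interpret dpm_problem T \<alpha> \<sigma> \<epsilon> xT x L
    using assms(2-4) by unfold_locales auto
  show ?thesis using dpm_solver_convergence[OF assms(1,5)] by meson
qed

end
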